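(* Let $A\in GL^{+}(3,\mathbb{R})$ have distinct singular values. Then, up to sign, there is a unique rank-one matrix $B_0=u_0\otimes v_0$ with $u_0,v_0\in\mathbb{R}^3$, $\|u_0\|=\|v_0\|=1$, having the following properties: (i) $\frac{d}{dt}\big|_{t=0}\mathcal{H}(A+tB_0)=0$ and $\frac{d^2}{dt^2}\big|_{t=0}\mathcal{H}(A+tB_0)<0$; (ii) $\frac{d^2}{dt^2}\big|_{t=0}\mathcal{H}(A+tB_0)\le\frac{d^2}{dt^2}\big|_{t=0}\mathcal{H}(A+tB)$ for all $B=u\otimes v$ with $u,v\in\mathbb{R}^3$, $\|u\|=\|v\|=1$ and $\frac{d}{dt}\big|_{t=0}\mathcal{H}(A+tB)=0$.
   Context: $GL^{+}(3,\mathbb{R})$ is the group of real $3\times3$ matrices with positive determinant. The linear distortion of $M\in GL^{+}(3,\mathbb{R})$ is $$\mathcal{H}(M)=\frac{\max_{|\zeta|=1}|M\zeta|}{\min_{|\zeta|=1}|M\zeta|},$$ the ratio of the largest to the smallest singular value of $M$ (equivalently $\sqrt{\lambda_3/\lambda_1}$, where $\lambda_1\le\lambda_2\le\lambda_3$ are the eigenvalues of $M^{T}M$). For column vectors $u,v\in\mathbb{R}^3$, $u\otimes v=uv^{T}$ is their tensor product; a matrix has rank one if and only if it is of this form with $u,v$ nonzero. Here $\|\cdot\|$ and $|\cdot|$ denote the Euclidean norm on $\mathbb{R}^3$.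
   Formalization: "Up to sign" includes, besides B₀ ↦ −B₀, reversing the sign of any pair of corresponding left and right singular vectors of A; uniqueness up to ±1 alone is false, as for diagonal A, B₀ and DB₀D (D a diagonal sign matrix) both satisfy (i), (ii). *)

theory Defs
  imports "HOL-Analysis.Analysis"
begin

text \<open>Supremum and infimum range over the compact unit sphere, so they are attained. The quotient
  is used for \<open>M\<close> close to an invertible matrix, where the denominator is positive.\<close>

definition linear_distortion :: "real^'n^'n \<Rightarrow> real" where
  "linear_distortion M =
     (SUP z\<in>sphere 0 1. norm (M *v z)) / (INF z\<in>sphere 0 1. norm (M *v z))"

definition tensor :: "real^'n \<Rightarrow> real^'n \<Rightarrow> real^'n^'n" where
  "tensor u v = (\<chi> i j. u $ i * v $ j)"

definition singular_values :: "real^'n^'n \<Rightarrow> real set" where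
  "singular_values A =
     {s. s \<ge> 0 \<and> (\<exists>x. x \<noteq> 0 \<and> (transpose A ** A) *v x = s\<^sup>2 *\<^sub>R x)}"

text \<open>Counted with multiplicity there are \<open>CARD('n)\<close> singular values, so they are pairwise distinct
  iff the set of singular values has that many elements.\<close>

definition has_distinct_singular_values :: "real^'n^'n \<Rightarrow> bool" where
  "has_distinct_singular_values A \<longleftrightarrow> card (singular_values A) = CARD('n)"

definition distortion_deriv1 :: "real^'n^'n \<Rightarrow> real^'n^'n \<Rightarrow> real" where
  "distortion_deriv1 A B = deriv (\<lambda>t. linear_distortion (A + t *\<^sub>R B)) 0"

definition distortion_deriv2 :: "real^'n^'n \<Rightarrow> real^'n^'n \<Rightarrow> real" where
  "distortion_deriv2 A B = (deriv ^^ 2) (\<lambda>t. linear_distortion (A + t *\<^sub>R B)) 0"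

definition extremal_direction :: "real^'n^'n \<Rightarrow> real^'n^'n \<Rightarrow> bool" where
  "extremal_direction A B0 \<longleftrightarrow>
     distortion_deriv1 A B0 = 0 \<and> distortion_deriv2 A B0 < 0 \<and>
     (\<forall>u v. norm u = 1 \<and> norm v = 1 \<and> distortion_deriv1 A (tensor u v) = 0 \<longrightarrow>
            distortion_deriv2 A B0 \<le> distortion_deriv2 A (tensor u v))"

text \<open>\<open>A = U S V\<^sup>T\<close>; the columns of \<open>U\<close> and \<open>V\<close> are left and right singular vectors of \<open>A\<close>.\<close>

definition singular_value_decomposition ::
    "real^'n^'n \<Rightarrow> real^'n^'n \<Rightarrow> real^'n^'n \<Rightarrow> real^'n^'n \<Rightarrow> bool" where
  "singular_value_decomposition A U S V \<longleftrightarrow>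
     orthogonal_matrix U \<and> orthogonal_matrix V \<and>
     (\<forall>i. S $ i $ i \<ge> 0) \<and> (\<forall>i j. i \<noteq> j \<longrightarrow> S $ i $ j = 0) \<and>
     A = U ** S ** transpose V"

text \<open>
  The meaning of ``up to sign'': besides \<open>B \<mapsto> - B\<close> (the factor \<open>e\<close>), one may reverse
  the sign of each pair of corresponding singular vectors of \<open>A\<close> (the factors \<open>d i\<close>).
  In singular coordinates, where \<open>A\<close> becomes the diagonal matrix \<open>S\<close>, the latter replaces a matrix
  \<open>B\<close> by \<open>D B D\<close> with \<open>D\<close> a diagonal matrix of signs. Because \<open>D S D = S\<close>, it preserves the
  distortion along the line \<open>S + t B\<close>. The single sign change \<open>B \<mapsto> - B\<close> would not be
  enough: a matrix \<open>u\<^sub>0 \<otimes> v\<^sub>0\<close> with \<open>D B D = B\<close> or \<open>D B D = - B\<close> for all \<open>D\<close> has only one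
  nonzero entry, and then the first derivative of the distortion is nonzero or the second one is
  nonnegative.
\<close>

definition equal_up_to_sign :: "real^'n^'n \<Rightarrow> real^'n^'n \<Rightarrow> real^'n^'n \<Rightarrow> bool" where
  "equal_up_to_sign A B B' \<longleftrightarrow>
     (\<exists>U S V e d. singular_value_decomposition A U S V \<and>
        e \<in> {1, -1} \<and> (\<forall>i. d i \<in> {1, -1}) \<and>
        (\<forall>i j. (transpose U ** B' ** V) $ i $ j =
                e * d i * d j * (transpose U ** B ** V) $ i $ j))"

end

theory Submission
  imports Defs
begin

text \<open>
  A singular value decomposition reduces the claim to \<open>A = diag(a, b, c)\<close> with \<open>0 < a < b < c\<close>. Along a rank-one
  line the squares of the extreme singular values are simple roots of a cubic whose coefficients
  are quadratic in \<open>t\<close>, so implicit differentiation gives the derivatives of \<open>\<H>\<close>.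
  With \<open>y\<^sub>i = u\<^sub>i v\<^sub>i\<close>, the direction is critical iff \<open>y\<^sub>1 = a k\<close> and \<open>y\<^sub>3 = c k\<close> for some
  \<open>k\<close>, and then \<open>\<H>'' / \<H>\<close> contains the \<open>u\<^sub>i\<^sup>2 v\<^sub>j\<^sup>2\<close> for \<open>i \<noteq> j\<close> only in combinations
  \<open>u\<^sub>i\<^sup>2 v\<^sub>j\<^sup>2 + u\<^sub>j\<^sup>2 v\<^sub>i\<^sup>2 \<ge> 2 \<bar>y\<^sub>i y\<^sub>j\<bar>\<close>. Together with \<open>\<bar>y\<^sub>1\<bar> + \<bar>y\<^sub>2\<bar> + \<bar>y\<^sub>3\<bar> \<le> 1\<close> this bounds the
  quotient below by a quadratic polynomial in \<open>\<bar>k\<bar>\<close>, negative at its unique minimizer. Equality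
  forces \<open>\<bar>u\<^sub>i\<bar> = \<bar>v\<^sub>i\<bar>\<close>, determines these numbers, and gives \<open>y\<^sub>2\<close> the sign opposite to \<open>k\<close>.
\<close>

section \<open>Extreme singular values\<close>

definition smax :: "real^'n^'m \<Rightarrow> real" where
  "smax M = (SUP z\<in>sphere 0 1. norm (M *v z))"

definition smin :: "real^'n^'m \<Rightarrow> real" where
  "smin M = (INF z\<in>sphere 0 1. norm (M *v z))"

lemma sphere_nonempty: "sphere 0 1 \<noteq> ({} :: (real^'n) set)"
  using vector_choose_size[where 'a = "real^'n" and c = 1] by auto

lemma continuous_on_norm_mult: "continuous_on X (\<lambda>z. norm ((M :: real^'n^'m) *v z))"
  by (intro continuous_intros linear_continuous_on matrix_vector_mul_bounded_linear)

lemma smax_attained: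
  fixes M :: "real^'n^'m"
  obtains z where "norm z = 1" "norm (M *v z) = smax M" "\<And>y. norm y = 1 \<Longrightarrow> norm (M *v y) \<le> smax M"
proof -
  obtain z where z: "z \<in> sphere 0 1" "\<forall>y\<in>sphere 0 1. norm (M *v y) \<le> norm (M *v z)"
    using continuous_attains_sup[OF compact_sphere sphere_nonempty continuous_on_norm_mult] by blast
  then have "smax M = norm (M *v z)"
    unfolding smax_def by (intro cSup_eq_maximum) auto
  with z that show thesis by (auto simp: dist_norm)
qed

lemma smin_attained:
  fixes M :: "real^'n^'m"
  obtains z where "norm z = 1" "norm (M *v z) = smin M" "\<And>y. norm y = 1 \<Longrightarrow> smin M \<le> norm (M *v y)"
proof -
  obtain z where z: "z \<in> sphere 0 1" "\<forall>y\<in>sphere 0 1. norm (M *v z) \<le> norm (M *v y)"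
    using continuous_attains_inf[OF compact_sphere sphere_nonempty continuous_on_norm_mult] by blast
  then have "smin M = norm (M *v z)"
    unfolding smin_def by (intro cInf_eq_minimum) auto
  with z that show thesis by (auto simp: dist_norm)
qed

lemma smax_nonneg: "0 \<le> smax M"
  using smax_attained[of M] norm_ge_zero by metis

lemma smin_nonneg: "0 \<le> smin M"
  using smin_attained[of M] norm_ge_zero by metis

text \<open>Evaluating at a maximizer for \<open>M\<close> gives a uniform perturbation bound. With
  its analogue for \<open>smin\<close> it yields Lipschitz continuity along a line of
  matrices.\<close>

lemma smax_le_add:
  assumes "\<And>z. norm z = 1 \<Longrightarrow> norm (M *v z) \<le> norm (N *v z) + e"
  shows "smax M \<le> smax N + e"
proof -
  obtain z where z: "norm z = 1" "norm (M *v z) = smax M" by (metis smax_attained)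
  moreover have "norm (N *v z) \<le> smax N" using z(1) by (metis smax_attained)
  ultimately show ?thesis using assms[of z] by linarith
qed

lemma smin_le_add:
  assumes "\<And>z. norm z = 1 \<Longrightarrow> norm (M *v z) \<le> norm (N *v z) + e"
  shows "smin M \<le> smin N + e"
proof -
  obtain z where z: "norm z = 1" "norm (N *v z) = smin N" by (metis smin_attained)
  moreover have "smin M \<le> norm (M *v z)" using z(1) by (metis smin_attained)
  ultimately show ?thesis using assms[of z] by linarith
qed

text \<open>A zero of a nonnegative quadratic form is a minimizer, so the gradient vanishes there.
  Concretely, moving from \<open>z\<close> against \<open>N *v z\<close> would make the form
  negative at first order.\<close>

lemma psd_null_vector:
  fixes N :: "real^'n^'n"
  assumes sym: "transpose N = N" and psd: "\<And>x. 0 \<le> x \<bullet> (N *v x)" and z: "z \<bullet> (N *v z) = 0"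
  shows "N *v z = 0"
proof (rule ccontr)
  assume "N *v z \<noteq> 0"
  define y where "y = N *v z"
  have yy: "y \<bullet> y > 0" using \<open>N *v z \<noteq> 0\<close> by (simp add: y_def)
  define q where "q = y \<bullet> (N *v y)"
  have zy: "z \<bullet> (N *v y) = y \<bullet> y"
    by (metis dot_lmul_matrix sym transpose_matrix_vector y_def)
  have zy': "z \<bullet> y = 0" using z by (simp add: y_def)
  have *: "0 \<le> 2 * r * (y \<bullet> y) + r\<^sup>2 * q" for r
  proof -
    have "(z + r *\<^sub>R y) \<bullet> (N *v (z + r *\<^sub>R y)) = 2 * r * (y \<bullet> y) + r\<^sup>2 * q"
      by (simp add: matrix_vector_right_distrib matrix_vector_mult_scaleR inner_add_left inner_add_right zy zy'
          q_def power2_eq_square algebra_simps flip: y_def)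
    then show ?thesis using psd[of "z + r *\<^sub>R y"] by simp
  qed
  have q0: "q \<ge> 0" using psd[of y] by (simp add: q_def)
  \<comment> \<open>This step length \<open>r\<close> satisfies
    \<open>y \<bullet> y = r * (q + 1)\<close>, so the form at \<open>z - r y\<close> equals
    \<open>- r^2 (q + 2)\<close>, which is negative.\<close>
  have "(y \<bullet> y) / (q + 1) > 0" using yy q0 by simp
  moreover define r where "r = (y \<bullet> y) / (q + 1)"
  moreover have "y \<bullet> y = r * (q + 1)" using q0 by (simp add: r_def)
  with *[of "- r"] have "0 \<le> r\<^sup>2 * (- q - 2)"
    by (simp add: algebra_simps power2_eq_square)
  ultimately show False using q0 by (simp add: zero_le_mult_iff)
qed

lemma norm_matrix_vector_sq: "(norm (M *v x))\<^sup>2 = x \<bullet> ((transpose M ** M) *v x)" for M :: "real^'n^'m"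
proof -
  have "x \<bullet> (transpose M *v (M *v x)) = ((M *v x) v* M) \<bullet> x"
    by (simp only: transpose_matrix_vector inner_commute)
  also have "\<dots> = (norm (M *v x))\<^sup>2"
    by (simp only: dot_lmul_matrix power2_norm_eq_inner)
  finally show ?thesis by (simp only: matrix_vector_mul_assoc)
qed

text \<open>The sign \<open>e\<close> is \<open>1\<close> for a maximum and \<open>-1\<close> for a minimum of the norm on the sphere; it makes
  \<open>e (s\<^sup>2 - M\<^sup>T M)\<close> positive semidefinite with null vector \<open>z\<close>.\<close>

lemma det_gram_zero:
  fixes M :: "real^'n^'n"
  assumes e: "e \<in> {1,-1}"
    and ext: "\<And>y. norm y = 1 \<Longrightarrow> e * (norm (M *v y))\<^sup>2 \<le> e * s\<^sup>2"
    and z: "norm z = 1" "norm (M *v z) = s"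
  shows "det (mat (s\<^sup>2) - transpose M ** M) = 0"
proof -
  define N where "N = e *\<^sub>R (mat (s\<^sup>2) - transpose M ** M)"
  have mv: "(mat k :: real^'n^'n) *v x = k *\<^sub>R x" for k :: real and x
    by (simp add: matrix_vector_mult_def mat_def vec_eq_iff if_distrib if_distribR cong: if_cong)
  have q: "x \<bullet> (N *v x) = e * (s\<^sup>2 * (norm x)\<^sup>2 - (norm (M *v x))\<^sup>2)" for x
    unfolding N_def norm_matrix_vector_sq
    by (simp add: matrix_vector_mult_diff_rdistrib inner_diff_right mv power2_norm_eq_inner
         scaleR_matrix_vector_assoc[symmetric])
  have "N *v z = 0"
  proof (rule psd_null_vector)
    show "transpose N = N"
      by (simp add: N_def vec_eq_iff transpose_def matrix_matrix_mult_def mat_def mult.commute)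
    show "z \<bullet> (N *v z) = 0" using z by (simp add: q)
    fix x
    show "0 \<le> x \<bullet> (N *v x)"
    proof (cases "x = 0")
      case False
      define y where "y = (1 / norm x) *\<^sub>R x"
      have y: "norm y = 1" "x = norm x *\<^sub>R y" using False by (auto simp: y_def)
      have "norm (M *v x) = norm (norm x *\<^sub>R (M *v y))"
        using y(2) by (metis matrix_vector_mult_scaleR)
      then have "x \<bullet> (N *v x) = (norm x)\<^sup>2 * (e * s\<^sup>2 - e * (norm (M *v y))\<^sup>2)"
        by (simp add: q algebra_simps power_mult_distrib)
      then show ?thesis using ext[OF y(1)] by simp
    qed simp
  qed
  then have "(mat (s\<^sup>2) - transpose M ** M) *v z = 0"
    using e by (auto simp: N_def scaleR_matrix_vector_assoc[symmetric])
  moreover have "z \<noteq> 0" using z(1) by auto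
  ultimately have "\<not> invertible (mat (s\<^sup>2) - transpose M ** M)"
    by (auto simp: invertible_left_inverse matrix_left_invertible_ker)
  then show ?thesis by (simp add: invertible_det_nz)
qed

lemma det_gram_smax: "det (mat ((smax M)\<^sup>2) - transpose M ** M) = 0" for M :: "real^'n^'n"
proof -
  obtain z where z: "norm z = 1" "norm (M *v z) = smax M" "\<And>y. norm y = 1 \<Longrightarrow> norm (M *v y) \<le> smax M"
    using smax_attained[of M] by blast
  show ?thesis by (rule det_gram_zero[of 1, OF _ _ z(1,2)]) (auto simp: z(3) power_mono)
qed

lemma det_gram_smin: "det (mat ((smin M)\<^sup>2) - transpose M ** M) = 0" for M :: "real^'n^'n"
proof -
  obtain z where z: "norm z = 1" "norm (M *v z) = smin M" "\<And>y. norm y = 1 \<Longrightarrow> smin M \<le> norm (M *v y)"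
    using smin_attained[of M] by blast
  show ?thesis by (rule det_gram_zero[of "-1", OF _ _ z(1,2)]) (auto simp: z(3) power_mono smin_nonneg)
qed

section \<open>Implicit differentiation\<close>

text \<open>The root is only known to be continuous, so differentiability is obtained by subtracting
  the equations at \<open>s\<close> and \<open>t\<close>. The increment \<open>g s - g t\<close>
  appears with a factor tending to the derivative of the cubic in its unknown, nonzero at a simple
  root; the remaining terms are increments of the coefficients.\<close>

lemma cubic_root_has_derivative:
  fixes g :: "real \<Rightarrow> real"
  assumes cont: "isCont g t"
    and root: "\<And>s. g s ^ 3 - e1 s * (g s)\<^sup>2 + e2 s * g s - e3 s = 0"
    and e: "(e1 has_real_derivative e1') (at t)" "(e2 has_real_derivative e2') (at t)"
      "(e3 has_real_derivative e3') (at t)"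
    and nz: "3 * (g t)\<^sup>2 - 2 * e1 t * g t + e2 t \<noteq> 0"
  shows "(g has_real_derivative (e1' * (g t)\<^sup>2 - e2' * g t + e3') / (3 * (g t)\<^sup>2 - 2 * e1 t * g t + e2 t)) (at t)"
proof -
  \<comment> \<open>The divided difference, between \<open>g s\<close> and \<open>g t\<close>, of
    the cubic with coefficients frozen at \<open>t\<close>.\<close>
  define K where "K s = (g s)\<^sup>2 + g s * g t + (g t)\<^sup>2 - e1 t * (g s + g t) + e2 t" for s
  define q where "q f s = (f s - f t) / (s - t)" for f :: "real \<Rightarrow> real" and s
  have g: "(g \<longlongrightarrow> g t) (at t)" using cont by (simp add: isCont_def)
  have K: "(K \<longlongrightarrow> 3 * (g t)\<^sup>2 - 2 * e1 t * g t + e2 t) (at t)"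
    unfolding K_def by (rule tendsto_eq_intros g refl | simp add: power2_eq_square algebra_simps)+
  have qe: "(q e1 \<longlongrightarrow> e1') (at t)" "(q e2 \<longlongrightarrow> e2') (at t)" "(q e3 \<longlongrightarrow> e3') (at t)"
    using e unfolding has_field_derivative_iff q_def by auto
  have lim: "((\<lambda>s. (q e1 s * (g s)\<^sup>2 - q e2 s * g s + q e3 s) / K s) \<longlongrightarrow>
      (e1' * (g t)\<^sup>2 - e2' * g t + e3') / (3 * (g t)\<^sup>2 - 2 * e1 t * g t + e2 t)) (at t)"
    by (intro tendsto_intros qe g K nz)
  have ev: "\<forall>\<^sub>F s in at t. K s \<noteq> 0 \<and> s \<noteq> t"
    using tendsto_imp_eventually_ne[OF K nz] eventually_neq_at_within[of t] by eventually_elim auto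
  have "\<forall>\<^sub>F s in at t. (q e1 s * (g s)\<^sup>2 - q e2 s * g s + q e3 s) / K s = q g s"
    using ev
  proof eventually_elim
    case (elim s)
    have "(g s - g t) * K s = (e1 s - e1 t) * (g s)\<^sup>2 - (e2 s - e2 t) * g s + (e3 s - e3 t)"
      using root[of s] root[of t] unfolding K_def by algebra
    also have "\<dots> = (s - t) * (q e1 s * (g s)\<^sup>2 - q e2 s * g s + q e3 s)"
    proof -
      have f: "f s - f t = (s - t) * q f s" for f using elim by (simp add: q_def)
      show ?thesis unfolding f by (simp add: algebra_simps)
    qed
    finally show ?case using elim by (simp add: q_def[of g] frac_eq_eq algebra_simps)
  qed
  from Lim_transform_eventually[OF lim this] show ?thesis
    unfolding has_field_derivative_iff q_def .
qed

text \<open>The root stays simple near \<open>0\<close>, so the first derivative is a quotient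
  \<open>n / d\<close> there and can be differentiated again at \<open>0\<close>. The values
  \<open>x\<close> and \<open>y\<close> enter through equations multiplied by \<open>D\<close>, so
  that proposed closed forms can be checked as polynomial identities.\<close>

lemma cubic_root_second_derivative:
  fixes g :: "real \<Rightarrow> real"
  assumes cont: "\<And>t. isCont g t"
    and root: "\<And>t. g t ^ 3 - (p1 + q1 * t + r1 * t\<^sup>2) * (g t)\<^sup>2 + (p2 + q2 * t + r2 * t\<^sup>2) * g t
       - (p3 + q3 * t + r3 * t\<^sup>2) = 0"
    and D: "D = 3 * (g 0)\<^sup>2 - 2 * p1 * g 0 + p2" "D \<noteq> 0"
    and x: "x * D = q1 * (g 0)\<^sup>2 - q2 * g 0 + q3"
    and y: "y * D = 2 * r1 * (g 0)\<^sup>2 + 2 * q1 * g 0 * x - 2 * r2 * g 0 - q2 * x + 2 * r3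
       - x * (6 * g 0 * x - 2 * q1 * g 0 - 2 * p1 * x + q2)"
  obtains g' where "\<forall>\<^sub>F t in nhds 0. (g has_real_derivative g' t) (at t)"
    "g' 0 = x" "(g' has_real_derivative y) (at 0)"
proof -
  define d where "d t = 3 * (g t)\<^sup>2 - 2 * (p1 + q1 * t + r1 * t\<^sup>2) * g t + (p2 + q2 * t + r2 * t\<^sup>2)" for t
  define n where "n t = (q1 + 2 * r1 * t) * (g t)\<^sup>2 - (q2 + 2 * r2 * t) * g t + (q3 + 2 * r3 * t)" for t
  have der: "(g has_real_derivative n t / d t) (at t)" if "d t \<noteq> 0" for t
    unfolding n_def d_def
    by (rule cubic_root_has_derivative[where ?e3.0 = "\<lambda>t. p3 + q3 * t + r3 * t\<^sup>2", OF cont root])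
       (use that in \<open>auto intro!: derivative_eq_intros simp: d_def\<close>)
  have d0: "d 0 = D" and n0: "n 0 = x * D" using x by (simp_all add: d_def n_def D)
  have "isCont d 0" unfolding d_def by (intro continuous_intros cont)
  then have "\<forall>\<^sub>F t in nhds 0. d t \<noteq> 0"
    using d0 D(2) by (simp add: eventually_nhds_conv_at isCont_def tendsto_imp_eventually_ne)
  then have 1: "\<forall>\<^sub>F t in nhds 0. (g has_real_derivative n t / d t) (at t)"
    by eventually_elim (rule der)
  have g0: "(g has_real_derivative x) (at 0)" using der[of 0] d0 n0 D(2) by simp
  have dn: "(n has_real_derivative 2 * r1 * (g 0)\<^sup>2 + 2 * q1 * g 0 * x - 2 * r2 * g 0 - q2 * x + 2 * r3) (at 0)"
    unfolding n_def by (rule derivative_eq_intros g0 refl | simp)+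
  have dd: "(d has_real_derivative 6 * g 0 * x - 2 * q1 * g 0 - 2 * p1 * x + q2) (at 0)"
    unfolding d_def by (rule derivative_eq_intros g0 refl | simp)+
  have "((\<lambda>t. n t / d t) has_real_derivative y) (at 0)"
  proof (rule DERIV_cong)
    show "((\<lambda>t. n t / d t) has_real_derivative
       ((y * D + x * (6 * g 0 * x - 2 * q1 * g 0 - 2 * p1 * x + q2)) * d 0
         - n 0 * (6 * g 0 * x - 2 * q1 * g 0 - 2 * p1 * x + q2)) / (d 0 * d 0)) (at 0)"
      using DERIV_divide[OF dn dd] d0 D(2) unfolding y by simp
    have "(y * D + x * k) * D - x * D * k = y * (D * D)" for k by (simp add: algebra_simps)
    then show "((y * D + x * (6 * g 0 * x - 2 * q1 * g 0 - 2 * p1 * x + q2)) * d 0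
         - n 0 * (6 * g 0 * x - 2 * q1 * g 0 - 2 * p1 * x + q2)) / (d 0 * d 0) = y"
      unfolding d0 n0 using D(2) by simp
  qed
  then show thesis using that[of "\<lambda>t. n t / d t"] 1 d0 n0 D(2) by simp
qed

text \<open>Logarithmic differentiation. At a critical point the squares of
  \<open>f' 0 / f 0\<close> and \<open>g' 0 / g 0\<close> agree and cancel, which leaves only the
  second derivatives of \<open>f\<close> and \<open>g\<close>.\<close>

lemma deriv_sqrt_quotient:
  fixes f g :: "real \<Rightarrow> real"
  assumes f: "\<forall>\<^sub>F t in nhds 0. (f has_real_derivative f' t) (at t)" "(f' has_real_derivative f2) (at 0)"
    and g: "\<forall>\<^sub>F t in nhds 0. (g has_real_derivative g' t) (at t)" "(g' has_real_derivative g2) (at 0)"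
    and pos: "f 0 > 0" "g 0 > 0"
  defines "h \<equiv> \<lambda>t. sqrt (f t / g t)"
  shows "deriv h 0 = h 0 / 2 * (f' 0 / f 0 - g' 0 / g 0)"
    and "f' 0 / f 0 = g' 0 / g 0 \<Longrightarrow> (deriv ^^ 2) h 0 = h 0 / 2 * (f2 / f 0 - g2 / g 0)"
proof -
  have df: "(f has_real_derivative f' 0) (at 0)" and dg: "(g has_real_derivative g' 0) (at 0)"
    using f(1) g(1) by (auto dest: eventually_nhds_x_imp_x)
  have "isCont f 0" "isCont g 0" using df dg DERIV_isCont by blast+
  then have ev: "\<forall>\<^sub>F t in nhds 0. f t > 0 \<and> g t > 0"
    using pos by (auto simp: eventually_conj_iff isCont_def eventually_nhds_conv_at order_tendstoD)
  have "\<forall>\<^sub>F t in nhds 0. (h has_real_derivative h t / 2 * (f' t / f t - g' t / g t)) (at t)"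
    using ev f(1) g(1)
  proof eventually_elim
    case (elim t)
    define r where "r = sqrt (f t / g t)"
    have r: "r > 0" "r\<^sup>2 = f t / g t" using elim by (auto simp: r_def)
    have "(h has_real_derivative ((f' t * g t - f t * g' t) / (g t * g t)) * (inverse r / 2)) (at t)"
      unfolding h_def r_def
      by (subst mult.commute, rule DERIV_chain2[OF DERIV_real_sqrt DERIV_divide]) (use elim in auto)
    moreover have "((f' t * g t - f t * g' t) / (g t * g t)) * (inverse r / 2) = r / 2 * (f' t / f t - g' t / g t)"
    proof -
      have e: "(f' t * g t - f t * g' t) / (g t * g t) = r\<^sup>2 * (f' t / f t - g' t / g t)"
        unfolding r using elim by (simp add: field_simps)
      show ?thesis unfolding e using r(1) by (simp add: power2_eq_square)
    qed
    ultimately show ?case by (simp only: h_def r_def)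
  qed
  then have dh: "(h has_real_derivative h 0 / 2 * (f' 0 / f 0 - g' 0 / g 0)) (at 0)"
    and "\<forall>\<^sub>F t in nhds 0. deriv h t = h t / 2 * (f' t / f t - g' t / g t)"
    by (rule eventually_nhds_x_imp_x, rule eventually_mono) (rule DERIV_imp_deriv)
  then have dd: "deriv (deriv h) 0 = deriv (\<lambda>t. h t / 2 * (f' t / f t - g' t / g t)) 0"
    by (intro deriv_cong_ev refl)
  show "deriv h 0 = h 0 / 2 * (f' 0 / f 0 - g' 0 / g 0)"
    using dh by (rule DERIV_imp_deriv)
  assume eq: "f' 0 / f 0 = g' 0 / g 0"
  \<comment> \<open>The vanishing first derivative removes the product-rule term in which the factor
    \<open>h\<close> is differentiated.\<close>
  have h0: "(h has_real_derivative 0) (at 0)" using dh eq by simp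
  have "((\<lambda>t. h t / 2 * (f' t / f t - g' t / g t)) has_real_derivative
     h 0 / 2 * ((f2 * f 0 - f' 0 * f' 0) / (f 0 * f 0) - (g2 * g 0 - g' 0 * g' 0) / (g 0 * g 0))) (at 0)"
    using DERIV_mult[OF DERIV_cdivide[OF h0, of 2]
        DERIV_diff[OF DERIV_divide[OF f(2) df] DERIV_divide[OF g(2) dg]]] pos by (simp add: mult.commute)
  also have "(f2 * f 0 - f' 0 * f' 0) / (f 0 * f 0) - (g2 * g 0 - g' 0 * g' 0) / (g 0 * g 0) =
      f2 / f 0 - (f' 0 / f 0)\<^sup>2 - (g2 / g 0 - (g' 0 / g 0)\<^sup>2)"
    using pos by (simp add: diff_divide_distrib power2_eq_square)
  also have "\<dots> = f2 / f 0 - g2 / g 0" by (simp add: eq)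
  finally show "(deriv ^^ 2) h 0 = h 0 / 2 * (f2 / f 0 - g2 / g 0)"
    using dd by (simp add: numeral_2_eq_2 DERIV_imp_deriv)
qed

section \<open>Derivatives of the distortion of a diagonal matrix\<close>

text \<open>The coefficients are the squared Frobenius norm, the sum of the squared 2x2 minors
  (Cauchy-Binet) and the squared determinant.\<close>

lemma det_gram_eq_cubic:
  fixes M :: "real^3^3"
  shows "det (mat l - transpose M ** M) = l ^ 3 -
    ((M$1$1)\<^sup>2 + (M$1$2)\<^sup>2 + (M$1$3)\<^sup>2 + (M$2$1)\<^sup>2 + (M$2$2)\<^sup>2 + (M$2$3)\<^sup>2
     + (M$3$1)\<^sup>2 + (M$3$2)\<^sup>2 + (M$3$3)\<^sup>2) * l\<^sup>2 +
    ((M$1$1 * M$2$2 - M$1$2 * M$2$1)\<^sup>2 + (M$1$1 * M$2$3 - M$1$3 * M$2$1)\<^sup>2 + (M$1$2 * M$2$3 - M$1$3 * M$2$2)\<^sup>2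
     + (M$1$1 * M$3$2 - M$1$2 * M$3$1)\<^sup>2 + (M$1$1 * M$3$3 - M$1$3 * M$3$1)\<^sup>2 + (M$1$2 * M$3$3 - M$1$3 * M$3$2)\<^sup>2
     + (M$2$1 * M$3$2 - M$2$2 * M$3$1)\<^sup>2 + (M$2$1 * M$3$3 - M$2$3 * M$3$1)\<^sup>2 + (M$2$2 * M$3$3 - M$2$3 * M$3$2)\<^sup>2) * l
    - (det M)\<^sup>2"
proof -
  have E: "(transpose M ** M) $ i $ j = M$1$i * M$1$j + M$2$i * M$2$j + M$3$i * M$3$j" for i j
    by (simp add: matrix_matrix_mult_def transpose_def sum_3)
  show ?thesis
    unfolding det_3 vector_minus_component E by (simp add: mat_def) algebra
qed

definition diag3 :: "real^3 \<Rightarrow> real^3^3" where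
  "diag3 s = (\<chi> i j. if i = j then s $ i else 0)"

text \<open>The 2x2 minors of \<open>tensor u v\<close> vanish, so every minor of order 2 or 3 along
  the line is affine in \<open>t\<close>. Hence all coefficients are quadratic in \<open>t\<close>,
  as \<open>cubic_root_second_derivative\<close> expects.\<close>

lemma det_gram_rank_one_line:
  fixes u v s :: "real^3"
  shows "det (mat l - transpose (diag3 s + t *\<^sub>R tensor u v) ** (diag3 s + t *\<^sub>R tensor u v)) =
   l ^ 3 - (((s$1)\<^sup>2 + (s$2)\<^sup>2 + (s$3)\<^sup>2) + 2 * (s$1 * u$1 * v$1 + s$2 * u$2 * v$2 + s$3 * u$3 * v$3) * t
      + ((u$1)\<^sup>2 + (u$2)\<^sup>2 + (u$3)\<^sup>2) * ((v$1)\<^sup>2 + (v$2)\<^sup>2 + (v$3)\<^sup>2) * t\<^sup>2) * l\<^sup>2 +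
     (((s$1 * s$2)\<^sup>2 + (s$1 * s$3)\<^sup>2 + (s$2 * s$3)\<^sup>2)
      + 2 * (s$1 * s$2 * (s$1 * u$2 * v$2 + s$2 * u$1 * v$1) + s$1 * s$3 * (s$1 * u$3 * v$3 + s$3 * u$1 * v$1)
           + s$2 * s$3 * (s$2 * u$3 * v$3 + s$3 * u$2 * v$2)) * t
      + ((s$1 * u$2 * v$2 + s$2 * u$1 * v$1)\<^sup>2 + (s$1 * u$3 * v$3 + s$3 * u$1 * v$1)\<^sup>2
           + (s$2 * u$3 * v$3 + s$3 * u$2 * v$2)\<^sup>2
         + (s$1)\<^sup>2 * ((u$2 * v$3)\<^sup>2 + (u$3 * v$2)\<^sup>2) + (s$2)\<^sup>2 * ((u$1 * v$3)\<^sup>2 + (u$3 * v$1)\<^sup>2)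
         + (s$3)\<^sup>2 * ((u$1 * v$2)\<^sup>2 + (u$2 * v$1)\<^sup>2)) * t\<^sup>2) * l
     - ((s$1 * s$2 * s$3)\<^sup>2
       + 2 * (s$1 * s$2 * s$3) * (s$2 * s$3 * u$1 * v$1 + s$1 * s$3 * u$2 * v$2 + s$1 * s$2 * u$3 * v$3) * t
       + (s$2 * s$3 * u$1 * v$1 + s$1 * s$3 * u$2 * v$2 + s$1 * s$2 * u$3 * v$3)\<^sup>2 * t\<^sup>2)"
  unfolding det_gram_eq_cubic unfolding det_3 diag3_def tensor_def by simp algebra

text \<open>Checks that the derivatives predicted by perturbation theory solve the implicit
  equations at the root \<open>c^2\<close>. The coefficients are named by equations, so that they
  can later be instantiated by reflexivity.\<close>

lemma gram_root_coefficients: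
  fixes a b c u1 u2 u3 v1 v2 v3 p1 q1 r1 p2 q2 r2 q3 r3 x y D :: real
  assumes "a\<^sup>2 \<noteq> c\<^sup>2" "b\<^sup>2 \<noteq> c\<^sup>2"
    and x: "x = 2 * c * u3 * v3"
    and y: "y = 2 * ((u1\<^sup>2 + u2\<^sup>2 + u3\<^sup>2) * v3\<^sup>2 + (c * u3 * v1 + a * u1 * v3)\<^sup>2 / (c\<^sup>2 - a\<^sup>2)
                + (c * u3 * v2 + b * u2 * v3)\<^sup>2 / (c\<^sup>2 - b\<^sup>2))"
    and p1: "p1 = a\<^sup>2 + b\<^sup>2 + c\<^sup>2" and q1: "q1 = 2 * (a * u1 * v1 + b * u2 * v2 + c * u3 * v3)"
    and r1: "r1 = (u1\<^sup>2 + u2\<^sup>2 + u3\<^sup>2) * (v1\<^sup>2 + v2\<^sup>2 + v3\<^sup>2)"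
    and p2: "p2 = (a * b)\<^sup>2 + (a * c)\<^sup>2 + (b * c)\<^sup>2"
    and q2: "q2 = 2 * (a * b * (a * u2 * v2 + b * u1 * v1) + a * c * (a * u3 * v3 + c * u1 * v1)
           + b * c * (b * u3 * v3 + c * u2 * v2))"
    and r2: "r2 = (a * u2 * v2 + b * u1 * v1)\<^sup>2 + (a * u3 * v3 + c * u1 * v1)\<^sup>2 + (b * u3 * v3 + c * u2 * v2)\<^sup>2
         + a\<^sup>2 * ((u2 * v3)\<^sup>2 + (u3 * v2)\<^sup>2) + b\<^sup>2 * ((u1 * v3)\<^sup>2 + (u3 * v1)\<^sup>2)
         + c\<^sup>2 * ((u1 * v2)\<^sup>2 + (u2 * v1)\<^sup>2)"
    and q3: "q3 = 2 * (a * b * c) * (b * c * u1 * v1 + a * c * u2 * v2 + a * b * u3 * v3)"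
    and r3: "r3 = (b * c * u1 * v1 + a * c * u2 * v2 + a * b * u3 * v3)\<^sup>2"
    and D: "D = 3 * (c\<^sup>2)\<^sup>2 - 2 * p1 * c\<^sup>2 + p2"
  shows "D \<noteq> 0" "x * D = q1 * (c\<^sup>2)\<^sup>2 - q2 * c\<^sup>2 + q3"
    "y * D = 2 * r1 * (c\<^sup>2)\<^sup>2 + 2 * q1 * c\<^sup>2 * x - 2 * r2 * c\<^sup>2 - q2 * x + 2 * r3
       - x * (6 * c\<^sup>2 * x - 2 * q1 * c\<^sup>2 - 2 * p1 * x + q2)"
proof -
  have D': "D = (c\<^sup>2 - a\<^sup>2) * (c\<^sup>2 - b\<^sup>2)" unfolding D p1 p2 by algebra
  show "D \<noteq> 0" unfolding D' using assms(1,2) by simp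
  show "x * D = q1 * (c\<^sup>2)\<^sup>2 - q2 * c\<^sup>2 + q3"
    unfolding D' x q1 q2 q3 by algebra
  \<comment> \<open>Since \<open>D\<close> is the product of the two denominators in
    \<open>y\<close>, multiplying by it leaves a polynomial identity.\<close>
  have "(w + g / A + h / B) * (A * B) = w * A * B + g * B + h * A" if "A \<noteq> 0" "B \<noteq> 0" for w g h A B :: real
    using that by (simp add: field_simps)
  then have "y * D = 2 * ((u1\<^sup>2 + u2\<^sup>2 + u3\<^sup>2) * v3\<^sup>2 * (c\<^sup>2 - a\<^sup>2) * (c\<^sup>2 - b\<^sup>2)
     + (c * u3 * v1 + a * u1 * v3)\<^sup>2 * (c\<^sup>2 - b\<^sup>2) + (c * u3 * v2 + b * u2 * v3)\<^sup>2 * (c\<^sup>2 - a\<^sup>2))"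
    unfolding D' y mult.assoc[of 2] using assms(1,2) by simp
  also have "\<dots> = 2 * r1 * (c\<^sup>2)\<^sup>2 + 2 * q1 * c\<^sup>2 * x - 2 * r2 * c\<^sup>2 - q2 * x + 2 * r3
       - x * (6 * c\<^sup>2 * x - 2 * q1 * c\<^sup>2 - 2 * p1 * x + q2)"
    unfolding x p1 q1 q2 r1 r2 r3 by algebra
  finally show "y * D = 2 * r1 * (c\<^sup>2)\<^sup>2 + 2 * q1 * c\<^sup>2 * x - 2 * r2 * c\<^sup>2 - q2 * x + 2 * r3
       - x * (6 * c\<^sup>2 * x - 2 * q1 * c\<^sup>2 - 2 * p1 * x + q2)" .
qed

text \<open>Both functions are Lipschitz in \<open>t\<close> with constant \<open>smax N\<close>.
  Continuity is what lets the extreme singular values be followed as roots of the cubic.\<close>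

lemma smax_line_continuous: "isCont (\<lambda>t. smax (M + t *\<^sub>R N)) t"
  and smin_line_continuous: "isCont (\<lambda>t. smin (M + t *\<^sub>R N)) t"
  for M N :: "real^'n^'m"
proof -
  have le: "norm ((M + t *\<^sub>R N) *v z) \<le> norm ((M + r *\<^sub>R N) *v z) + smax N * dist t r"
    if "norm z = 1" for z t r
  proof -
    have "(M + t *\<^sub>R N) *v z = (M + r *\<^sub>R N) *v z + (t - r) *\<^sub>R (N *v z)"
      by (simp add: matrix_vector_mult_add_rdistrib scaleR_matrix_vector_assoc[symmetric] scaleR_left_diff_distrib)
    moreover have "norm ((t - r) *\<^sub>R (N *v z)) \<le> smax N * dist t r"
      using that smax_attained[of N]
      by (simp add: dist_real_def mult.commute) (metis abs_ge_zero mult.commute mult_left_mono)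
    ultimately show ?thesis by (metis norm_triangle_le add_left_mono)
  qed
  have lipschitz: "continuous_on UNIV f" if "\<And>t r. f t \<le> f r + smax N * dist t r" for f :: "real \<Rightarrow> real"
  proof (rule lipschitz_on_continuous_on, rule lipschitz_onI)
    show "dist (f t) (f r) \<le> smax N * dist t r" for t r
      using that[of t r] that[of r t] by (simp add: dist_real_def abs_le_iff abs_minus_commute)
  qed (rule smax_nonneg)
  have "continuous_on UNIV (\<lambda>t. smax (M + t *\<^sub>R N))" "continuous_on UNIV (\<lambda>t. smin (M + t *\<^sub>R N))"
    by (rule lipschitz, rule smax_le_add smin_le_add, erule le)+
  then show "isCont (\<lambda>t. smax (M + t *\<^sub>R N)) t" "isCont (\<lambda>t. smin (M + t *\<^sub>R N)) t"
    by (simp_all add: continuous_on_eq_continuous_at)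
qed

section \<open>Extreme singular values of a diagonal matrix\<close>

lemma norm_sq_3: "(norm (z :: real^3))\<^sup>2 = (z$1)\<^sup>2 + (z$2)\<^sup>2 + (z$3)\<^sup>2"
  by (simp add: norm_vec_def L2_set_def sum_3)

lemma diag3_mult_nth: "(diag3 s *v z) $ i = s $ i * z $ i"
proof -
  have "(diag3 s *v z) $ i = (\<Sum>j\<in>UNIV. if i = j then s $ i * z $ j else 0)"
    unfolding matrix_vector_mult_def diag3_def vec_lambda_beta by (intro sum.cong refl) simp
  then show ?thesis by simp
qed

lemma norm_diag3_sq: "(norm (diag3 s *v z))\<^sup>2 = (s$1)\<^sup>2 * (z$1)\<^sup>2 + (s$2)\<^sup>2 * (z$2)\<^sup>2 + (s$3)\<^sup>2 * (z$3)\<^sup>2"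
  by (simp add: norm_sq_3 diag3_mult_nth power_mult_distrib)

lemma smax_diag3:
  assumes "0 < s$1" "s$1 < s$2" "s$2 < s$3"
  shows "smax (diag3 s) = s$3"
proof (rule antisym)
  obtain z where z: "norm z = 1" "norm (diag3 s *v z) = smax (diag3 s)" using smax_attained[of "diag3 s"] by metis
  have "(s$1)\<^sup>2 \<le> (s$3)\<^sup>2" "(s$2)\<^sup>2 \<le> (s$3)\<^sup>2" using assms by (auto intro!: power_mono)
  then have "(s$1)\<^sup>2 * (z$1)\<^sup>2 + (s$2)\<^sup>2 * (z$2)\<^sup>2 + (s$3)\<^sup>2 * (z$3)\<^sup>2
     \<le> (s$3)\<^sup>2 * (z$1)\<^sup>2 + (s$3)\<^sup>2 * (z$2)\<^sup>2 + (s$3)\<^sup>2 * (z$3)\<^sup>2"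
    by (intro add_mono mult_right_mono) auto
  also have "\<dots> = (s$3)\<^sup>2" using norm_sq_3[of z] z(1) by (simp flip: distrib_left)
  finally show "smax (diag3 s) \<le> s$3"
    using z(2) norm_diag3_sq[of s z] assms by (auto intro: power2_le_imp_le)
  have "(norm (diag3 s *v axis 3 1))\<^sup>2 = (s$3)\<^sup>2" unfolding norm_diag3_sq by (simp add: axis_def)
  then have "norm (diag3 s *v axis 3 1) = s$3" using assms by (simp add: power2_eq_iff_nonneg)
  moreover have "norm (diag3 s *v axis 3 1) \<le> smax (diag3 s)"
    using smax_attained[of "diag3 s"] by (metis norm_axis_1)
  ultimately show "s$3 \<le> smax (diag3 s)" by simp
qed

lemma smin_diag3:
  assumes "0 < s$1" "s$1 < s$2" "s$2 < s$3"
  shows "smin (diag3 s) = s$1"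
proof (rule antisym)
  obtain z where z: "norm z = 1" "norm (diag3 s *v z) = smin (diag3 s)" using smin_attained[of "diag3 s"] by metis
  have "(s$1)\<^sup>2 \<le> (s$3)\<^sup>2" "(s$1)\<^sup>2 \<le> (s$2)\<^sup>2" using assms by (auto intro!: power_mono)
  then have "(s$1)\<^sup>2 * (z$1)\<^sup>2 + (s$1)\<^sup>2 * (z$2)\<^sup>2 + (s$1)\<^sup>2 * (z$3)\<^sup>2
     \<le> (s$1)\<^sup>2 * (z$1)\<^sup>2 + (s$2)\<^sup>2 * (z$2)\<^sup>2 + (s$3)\<^sup>2 * (z$3)\<^sup>2"
    by (intro add_mono mult_right_mono) auto
  moreover have "(s$1)\<^sup>2 * (z$1)\<^sup>2 + (s$1)\<^sup>2 * (z$2)\<^sup>2 + (s$1)\<^sup>2 * (z$3)\<^sup>2 = (s$1)\<^sup>2"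
    using norm_sq_3[of z] z(1) by (simp flip: distrib_left)
  ultimately show "s$1 \<le> smin (diag3 s)"
    using z(2) norm_diag3_sq[of s z] smin_nonneg[of "diag3 s"] by (auto intro: power2_le_imp_le)
  have "(norm (diag3 s *v axis 1 1))\<^sup>2 = (s$1)\<^sup>2" unfolding norm_diag3_sq by (simp add: axis_def)
  then have "norm (diag3 s *v axis 1 1) = s$1" using assms by (simp add: power2_eq_iff_nonneg)
  moreover have "smin (diag3 s) \<le> norm (diag3 s *v axis 1 1)"
    using smin_attained[of "diag3 s"] by (metis norm_axis_1)
  ultimately show "smin (diag3 s) \<le> s$1" by simp
qed

text \<open>Half the second derivative at \<open>t = 0\<close> of the eigenvalue \<open>c\<^sup>2\<close> of \<open>M\<^sup>T M\<close> for
  \<open>M = diag(a, b, c) + t (u \<otimes> v)\<close>, as given by second-order perturbation theory.\<close>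

definition gram_curvature :: "real \<Rightarrow> real \<Rightarrow> real \<Rightarrow> real \<Rightarrow> real \<Rightarrow> real \<Rightarrow> real \<Rightarrow> real \<Rightarrow> real \<Rightarrow> real" where
  "gram_curvature a b c u1 u2 u3 v1 v2 v3 =
     (u1\<^sup>2 + u2\<^sup>2 + u3\<^sup>2) * v3\<^sup>2 + (c * u3 * v1 + a * u1 * v3)\<^sup>2 / (c\<^sup>2 - a\<^sup>2)
        + (c * u3 * v2 + b * u2 * v3)\<^sup>2 / (c\<^sup>2 - b\<^sup>2)"

text \<open>The coefficients are symmetric under simultaneous permutations of \<open>(a, b, c)\<close>, \<open>(u1, u2, u3)\<close>
  and \<open>(v1, v2, v3)\<close>, so this serves both extreme singular values.\<close>

lemma gram_root_derivatives:
  fixes L :: "real \<Rightarrow> real"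
  assumes cont: "\<And>t. isCont L t" and L0: "L 0 = c\<^sup>2" and ne: "a\<^sup>2 \<noteq> c\<^sup>2" "b\<^sup>2 \<noteq> c\<^sup>2"
    and root: "\<And>t. L t ^ 3 - ((a\<^sup>2 + b\<^sup>2 + c\<^sup>2) + 2 * (a * u1 * v1 + b * u2 * v2 + c * u3 * v3) * t
      + (u1\<^sup>2 + u2\<^sup>2 + u3\<^sup>2) * (v1\<^sup>2 + v2\<^sup>2 + v3\<^sup>2) * t\<^sup>2) * (L t)\<^sup>2 +
     (((a * b)\<^sup>2 + (a * c)\<^sup>2 + (b * c)\<^sup>2)
      + 2 * (a * b * (a * u2 * v2 + b * u1 * v1) + a * c * (a * u3 * v3 + c * u1 * v1)
           + b * c * (b * u3 * v3 + c * u2 * v2)) * t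
      + ((a * u2 * v2 + b * u1 * v1)\<^sup>2 + (a * u3 * v3 + c * u1 * v1)\<^sup>2 + (b * u3 * v3 + c * u2 * v2)\<^sup>2
         + a\<^sup>2 * ((u2 * v3)\<^sup>2 + (u3 * v2)\<^sup>2) + b\<^sup>2 * ((u1 * v3)\<^sup>2 + (u3 * v1)\<^sup>2)
         + c\<^sup>2 * ((u1 * v2)\<^sup>2 + (u2 * v1)\<^sup>2)) * t\<^sup>2) * L t
     - ((a * b * c)\<^sup>2 + 2 * (a * b * c) * (b * c * u1 * v1 + a * c * u2 * v2 + a * b * u3 * v3) * t
       + (b * c * u1 * v1 + a * c * u2 * v2 + a * b * u3 * v3)\<^sup>2 * t\<^sup>2) = 0"
  obtains L' where "\<forall>\<^sub>F t in nhds 0. (L has_real_derivative L' t) (at t)"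
    "L' 0 = 2 * c * u3 * v3"
    "(L' has_real_derivative 2 * gram_curvature a b c u1 u2 u3 v1 v2 v3) (at 0)"
proof -
  note alg = gram_root_coefficients[OF ne refl refl refl refl refl refl refl refl refl refl refl]
  show thesis
    by (rule cubic_root_second_derivative[OF cont root refl, unfolded L0, OF alg],
        rule that[unfolded gram_curvature_def])
qed

text \<open>The distortion is \<open>sqrt (f t / g t)\<close>, where \<open>f\<close> and
  \<open>g\<close> are the squares of the extreme singular values along the line. Both are
  continuous roots of the same cubic and start at the simple roots \<open>(s$3)^2\<close> and
  \<open>(s$1)^2\<close>.\<close>

lemma distortion_diag3:
  fixes s u v :: "real^3"
  assumes s: "0 < s$1" "s$1 < s$2" "s$2 < s$3"
  shows "distortion_deriv1 (diag3 s) (tensor u v) = s$3 / s$1 * (u$3 * v$3 / s$3 - u$1 * v$1 / s$1)"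
    and "u$3 * v$3 / s$3 = u$1 * v$1 / s$1 \<Longrightarrow>
      distortion_deriv2 (diag3 s) (tensor u v) =
      s$3 / s$1 * (gram_curvature (s$1) (s$2) (s$3) (u$1) (u$2) (u$3) (v$1) (v$2) (v$3) / (s$3)\<^sup>2
         - gram_curvature (s$3) (s$2) (s$1) (u$3) (u$2) (u$1) (v$3) (v$2) (v$1) / (s$1)\<^sup>2)"
proof -
  define M where "M t = diag3 s + t *\<^sub>R tensor u v" for t
  define f where "f t = (smax (M t))\<^sup>2" for t
  define g where "g t = (smin (M t))\<^sup>2" for t
  have f0: "f 0 = (s$3)\<^sup>2" and g0: "g 0 = (s$1)\<^sup>2"
    using smax_diag3[OF s] smin_diag3[OF s] by (simp_all add: f_def g_def M_def)
  have cf: "isCont f t" and cg: "isCont g t" for t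
    unfolding f_def g_def M_def by (intro continuous_intros smax_line_continuous smin_line_continuous)+
  have ne: "(s$1)\<^sup>2 \<noteq> (s$3)\<^sup>2" "(s$2)\<^sup>2 \<noteq> (s$3)\<^sup>2" "(s$2)\<^sup>2 \<noteq> (s$1)\<^sup>2"
    using s by (auto simp: power2_eq_iff)
  note cubic_f = det_gram_smax[of "M t" for t, unfolded M_def det_gram_rank_one_line, folded M_def f_def]
  note cubic_g = det_gram_smin[of "M t" for t, unfolded M_def det_gram_rank_one_line, folded M_def g_def]
  obtain f' where f': "\<forall>\<^sub>F t in nhds 0. (f has_real_derivative f' t) (at t)"
    "f' 0 = 2 * s$3 * u$3 * v$3"
    "(f' has_real_derivative 2 * gram_curvature (s$1) (s$2) (s$3) (u$1) (u$2) (u$3) (v$1) (v$2) (v$3)) (at 0)"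
    by (rule gram_root_derivatives[OF cf f0 ne(1,2) cubic_f])
  \<comment> \<open>The same cubic with the indices 1 and 3 exchanged, so that the smallest
    eigenvalue takes the place of \<open>c^2\<close> in
    \<open>gram_root_derivatives\<close>.\<close>
  have "(g t) ^ 3 - (((s$3)\<^sup>2 + (s$2)\<^sup>2 + (s$1)\<^sup>2) + 2 * (s$3 * u$3 * v$3 + s$2 * u$2 * v$2 + s$1 * u$1 * v$1) * t
      + ((u$3)\<^sup>2 + (u$2)\<^sup>2 + (u$1)\<^sup>2) * ((v$3)\<^sup>2 + (v$2)\<^sup>2 + (v$1)\<^sup>2) * t\<^sup>2) * (g t)\<^sup>2 +
     (((s$3 * s$2)\<^sup>2 + (s$3 * s$1)\<^sup>2 + (s$2 * s$1)\<^sup>2)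
      + 2 * (s$3 * s$2 * (s$3 * u$2 * v$2 + s$2 * u$3 * v$3) + s$3 * s$1 * (s$3 * u$1 * v$1 + s$1 * u$3 * v$3)
           + s$2 * s$1 * (s$2 * u$1 * v$1 + s$1 * u$2 * v$2)) * t
      + ((s$3 * u$2 * v$2 + s$2 * u$3 * v$3)\<^sup>2 + (s$3 * u$1 * v$1 + s$1 * u$3 * v$3)\<^sup>2 + (s$2 * u$1 * v$1 + s$1 * u$2 * v$2)\<^sup>2
         + (s$3)\<^sup>2 * ((u$2 * v$1)\<^sup>2 + (u$1 * v$2)\<^sup>2) + (s$2)\<^sup>2 * ((u$3 * v$1)\<^sup>2 + (u$1 * v$3)\<^sup>2)
         + (s$1)\<^sup>2 * ((u$3 * v$2)\<^sup>2 + (u$2 * v$3)\<^sup>2)) * t\<^sup>2) * g t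
     - ((s$3 * s$2 * s$1)\<^sup>2 + 2 * (s$3 * s$2 * s$1) * (s$2 * s$1 * u$3 * v$3 + s$3 * s$1 * u$2 * v$2 + s$3 * s$2 * u$1 * v$1) * t
       + (s$2 * s$1 * u$3 * v$3 + s$3 * s$1 * u$2 * v$2 + s$3 * s$2 * u$1 * v$1)\<^sup>2 * t\<^sup>2) = 0" for t
    by (rule trans[OF _ cubic_g[of t]]) algebra
  from gram_root_derivatives[OF cg g0 ne(1)[symmetric] ne(3) this]
  obtain g' where g': "\<forall>\<^sub>F t in nhds 0. (g has_real_derivative g' t) (at t)"
    "g' 0 = 2 * s$1 * u$1 * v$1"
    "(g' has_real_derivative 2 * gram_curvature (s$3) (s$2) (s$1) (u$3) (u$2) (u$1) (v$3) (v$2) (v$1)) (at 0)"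
    by blast
  have pos: "f 0 > 0" "g 0 > 0" using s by (simp_all add: f0 g0)
  have H: "linear_distortion (M t) = sqrt (f t / g t)" for t
    by (simp add: linear_distortion_def f_def g_def real_sqrt_divide smax_nonneg smin_nonneg flip: smax_def smin_def)
  have h0: "sqrt ((s$3)\<^sup>2 / (s$1)\<^sup>2) = s$3 / s$1"
    using s by (simp add: real_sqrt_divide)
  note d = deriv_sqrt_quotient[OF f'(1,3) g'(1,3) pos, folded H, unfolded H[of 0] f0 g0 h0 f'(2) g'(2)]
  have e: "2 * s$3 * u$3 * v$3 / (s$3)\<^sup>2 = 2 * (u$3 * v$3 / s$3)" "2 * s$1 * u$1 * v$1 / (s$1)\<^sup>2 = 2 * (u$1 * v$1 / s$1)"
    using s by (simp_all add: power2_eq_square)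
  have half: "h / 2 * (2 * x / p - 2 * y / q) = h * (x / p - y / q)"
    "h / 2 * (2 * x - 2 * y) = h * (x - y)" for h x y p q :: real
    by (simp_all add: algebra_simps)
  show "distortion_deriv1 (diag3 s) (tensor u v) = s$3 / s$1 * (u$3 * v$3 / s$3 - u$1 * v$1 / s$1)"
    unfolding distortion_deriv1_def d(1)[unfolded M_def e half] ..
  show "distortion_deriv2 (diag3 s) (tensor u v) =
      s$3 / s$1 * (gram_curvature (s$1) (s$2) (s$3) (u$1) (u$2) (u$3) (v$1) (v$2) (v$3) / (s$3)\<^sup>2
         - gram_curvature (s$3) (s$2) (s$1) (u$3) (u$2) (u$1) (v$3) (v$2) (v$1) / (s$1)\<^sup>2)"
    if "u$3 * v$3 / s$3 = u$1 * v$1 / s$1"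
    unfolding distortion_deriv2_def by (rule d(2)[unfolded M_def e half]) (simp only: that)
qed

section \<open>Minimization of the second derivative\<close>

text \<open>The ratio \<open>\<H>'' / \<H>\<close> in a critical direction.\<close>

definition gap :: "real^3 \<Rightarrow> real^3 \<Rightarrow> real^3 \<Rightarrow> real" where
  "gap s u v = gram_curvature (s$1) (s$2) (s$3) (u$1) (u$2) (u$3) (v$1) (v$2) (v$3) / (s$3)\<^sup>2
         - gram_curvature (s$3) (s$2) (s$1) (u$3) (u$2) (u$1) (v$3) (v$2) (v$1) / (s$1)\<^sup>2"

text \<open>The terms \<open>a^2 p^2\<close> cancel, which gives \<open>p^2\<close> and
  \<open>q^2\<close> equal coefficients. For \<open>p = u1 * v3\<close> and
  \<open>q = u3 * v1\<close> the product \<open>p * q\<close> is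
  \<open>(u1 * v1) * (u3 * v3)\<close>, so mixed products survive only as a sum of two
  squares.\<close>

lemma combine_pair_terms:
  fixes a c p q :: real
  assumes "c \<noteq> 0" "c\<^sup>2 \<noteq> a\<^sup>2"
  shows "p\<^sup>2 / c\<^sup>2 + (c * q + a * p)\<^sup>2 / (c\<^sup>2 - a\<^sup>2) / c\<^sup>2 = (p\<^sup>2 + q\<^sup>2 + 2 * (a * (p * q / c))) / (c\<^sup>2 - a\<^sup>2)"
proof -
  have "p\<^sup>2 / c\<^sup>2 + (c * q + a * p)\<^sup>2 / (c\<^sup>2 - a\<^sup>2) / c\<^sup>2 = (p\<^sup>2 * (c\<^sup>2 - a\<^sup>2) + (c * q + a * p)\<^sup>2) / ((c\<^sup>2 - a\<^sup>2) * c\<^sup>2)"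
    using assms by (simp add: add_divide_distrib)
  also have "p\<^sup>2 * (c\<^sup>2 - a\<^sup>2) + (c * q + a * p)\<^sup>2 = (p\<^sup>2 + q\<^sup>2 + 2 * (a * (p * q / c))) * c\<^sup>2"
    using assms(1) by (simp add: power2_eq_square field_simps)
  finally show ?thesis using assms(1) by simp
qed

lemma gram_curvature_eq:
  assumes "c \<noteq> 0" "c\<^sup>2 \<noteq> a\<^sup>2" "c\<^sup>2 \<noteq> b\<^sup>2"
  shows "gram_curvature a b c u1 u2 u3 v1 v2 v3 / c\<^sup>2 = (u3 * v3 / c)\<^sup>2
    + ((u1 * v3)\<^sup>2 + (u3 * v1)\<^sup>2 + 2 * (a * (u1 * v1 * (u3 * v3 / c)))) / (c\<^sup>2 - a\<^sup>2)
    + ((u2 * v3)\<^sup>2 + (u3 * v2)\<^sup>2 + 2 * (b * (u2 * v2 * (u3 * v3 / c)))) / (c\<^sup>2 - b\<^sup>2)"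
proof -
  have "gram_curvature a b c u1 u2 u3 v1 v2 v3 / c\<^sup>2 = (u3 * v3 / c)\<^sup>2
     + ((u1 * v3)\<^sup>2 / c\<^sup>2 + (c * (u3 * v1) + a * (u1 * v3))\<^sup>2 / (c\<^sup>2 - a\<^sup>2) / c\<^sup>2)
     + ((u2 * v3)\<^sup>2 / c\<^sup>2 + (c * (u3 * v2) + b * (u2 * v3))\<^sup>2 / (c\<^sup>2 - b\<^sup>2) / c\<^sup>2)"
    by (simp add: gram_curvature_def add_divide_distrib distrib_right power_mult_distrib power_divide mult.assoc)
  then show ?thesis
    unfolding combine_pair_terms[OF assms(1,2)] combine_pair_terms[OF assms(1,3)] by (simp add: mult_ac)
qed

text \<open>The isolated squares in the two curvatures both equal \<open>k^2\<close> and cancel.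
  Flipping the negative denominators of the smallest eigenvalue makes all denominators positive, and
  the pair (1,3), which occurs in both curvatures, is merged.\<close>

lemma gap_eq:
  fixes s u v :: "real^3"
  assumes s: "0 < s$1" "s$1 < s$2" "s$2 < s$3"
    and k: "u$3 * v$3 = s$3 * k" "u$1 * v$1 = s$1 * k"
  shows "gap s u v =
     ((u$1 * v$2)\<^sup>2 + (u$2 * v$1)\<^sup>2 + 2 * s$2 * (u$2 * v$2 * k)) / ((s$2)\<^sup>2 - (s$1)\<^sup>2)
   + ((u$3 * v$2)\<^sup>2 + (u$2 * v$3)\<^sup>2 + 2 * s$2 * (u$2 * v$2 * k)) / ((s$3)\<^sup>2 - (s$2)\<^sup>2)
   + 2 * ((u$1 * v$3)\<^sup>2 + (u$3 * v$1)\<^sup>2 + ((s$1)\<^sup>2 + (s$3)\<^sup>2) * k\<^sup>2) / ((s$3)\<^sup>2 - (s$1)\<^sup>2)"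
proof -
  have ne: "(s$1)\<^sup>2 \<noteq> (s$3)\<^sup>2" "(s$2)\<^sup>2 \<noteq> (s$3)\<^sup>2" "(s$2)\<^sup>2 \<noteq> (s$1)\<^sup>2"
    using s by (auto simp: power2_eq_iff)
  have k': "u$3 * v$3 / s$3 = k" "u$1 * v$1 / s$1 = k" using s k by auto
  have "gap s u v = (((u$1 * v$3)\<^sup>2 + (u$3 * v$1)\<^sup>2 + 2 * (s$1 * (s$1 * k * k))) / ((s$3)\<^sup>2 - (s$1)\<^sup>2)
    + ((u$2 * v$3)\<^sup>2 + (u$3 * v$2)\<^sup>2 + 2 * (s$2 * (u$2 * v$2 * k))) / ((s$3)\<^sup>2 - (s$2)\<^sup>2))
    - (((u$3 * v$1)\<^sup>2 + (u$1 * v$3)\<^sup>2 + 2 * (s$3 * (s$3 * k * k))) / ((s$1)\<^sup>2 - (s$3)\<^sup>2)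
    + ((u$2 * v$1)\<^sup>2 + (u$1 * v$2)\<^sup>2 + 2 * (s$2 * (u$2 * v$2 * k))) / ((s$1)\<^sup>2 - (s$2)\<^sup>2))"
    unfolding gap_def using s ne by (subst (1 2) gram_curvature_eq) (auto simp: k' k)
  also have "\<dots> = ((u$2 * v$1)\<^sup>2 + (u$1 * v$2)\<^sup>2 + 2 * (s$2 * (u$2 * v$2 * k))) / ((s$2)\<^sup>2 - (s$1)\<^sup>2)
    + ((u$2 * v$3)\<^sup>2 + (u$3 * v$2)\<^sup>2 + 2 * (s$2 * (u$2 * v$2 * k))) / ((s$3)\<^sup>2 - (s$2)\<^sup>2)
    + (((u$1 * v$3)\<^sup>2 + (u$3 * v$1)\<^sup>2 + 2 * (s$1 * (s$1 * k * k)))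
     + ((u$3 * v$1)\<^sup>2 + (u$1 * v$3)\<^sup>2 + 2 * (s$3 * (s$3 * k * k)))) / ((s$3)\<^sup>2 - (s$1)\<^sup>2)"
  proof -
    have flip: "x / (p - q) = - (x / (q - p))" for x p q :: real
      by (metis minus_diff_eq minus_divide_right)
    show ?thesis
      unfolding flip[of _ "(s$1)\<^sup>2" "(s$3)\<^sup>2"] flip[of _ "(s$1)\<^sup>2" "(s$2)\<^sup>2"]
        add_divide_distrib[of "_ + _ + _" "_ + _ + _"] by simp
  qed
  finally show ?thesis by (simp add: power2_eq_square algebra_simps)
qed

text \<open>The inequality of arithmetic and geometric means replaces each pair of mixed squares by
  twice the product of two of the \<open>\<bar>u$i * v$i\<bar>\<close>, with equality when
  \<open>\<bar>u$i\<bar> = \<bar>v$i\<bar>\<close>. The last summand of \<open>R\<close> is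
  nonnegative and isolates the influence of the sign of \<open>u$2 * v$2 * k\<close>.\<close>

lemma gap_lower_bound:
  fixes s u v :: "real^3"
  assumes s: "0 < s$1" "s$1 < s$2" "s$2 < s$3"
    and k: "u$3 * v$3 = s$3 * k" "u$1 * v$1 = s$1 * k"
  defines "g \<equiv> (s$3 - s$1) / ((s$1 + s$2) * (s$2 + s$3))" and "K \<equiv> \<bar>k\<bar>" and "y \<equiv> \<bar>u$2 * v$2\<bar>"
    and "\<beta> \<equiv> 1 / ((s$2)\<^sup>2 - (s$1)\<^sup>2) + 1 / ((s$3)\<^sup>2 - (s$2)\<^sup>2)"
  defines "R \<equiv> - 2 * g * K * y + 2 * (s$1 + s$3) / (s$3 - s$1) * K\<^sup>2 + 2 * s$2 * \<beta> * (u$2 * v$2 * k + y * K)"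
  shows "R \<le> gap s u v"
    and "\<bar>u$1\<bar> = \<bar>v$1\<bar> \<Longrightarrow> \<bar>u$2\<bar> = \<bar>v$2\<bar> \<Longrightarrow> \<bar>u$3\<bar> = \<bar>v$3\<bar> \<Longrightarrow> gap s u v = R"
proof -
  define a b c where abc: "a = s$1" "b = s$2" "c = s$3"
  have pos: "0 < a" "a < b" "b < c" using s by (simp_all add: abc)
  have sq: "a\<^sup>2 < b\<^sup>2" "b\<^sup>2 < c\<^sup>2" "a\<^sup>2 < c\<^sup>2" using pos by (auto intro!: power_strict_mono)
  have yk: "\<bar>u$1 * v$1\<bar> = a * K" "\<bar>u$3 * v$3\<bar> = c * K" using pos k by (auto simp: abc K_def abs_mult)
  have amgm: "2 * (\<bar>p * q\<bar> * \<bar>r * t\<bar>) \<le> (p * t)\<^sup>2 + (r * q)\<^sup>2" for p q r t :: real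
    using sum_squares_bound[of "\<bar>p * t\<bar>" "\<bar>r * q\<bar>"] unfolding power2_abs
    by (simp add: abs_mult mult_ac)
  have fact: "b\<^sup>2 - a\<^sup>2 = (b - a) * (a + b)" "c\<^sup>2 - b\<^sup>2 = (c - b) * (b + c)" "c\<^sup>2 - a\<^sup>2 = (c - a) * (a + c)"
    by algebra+
  have id: "(2 * (a * K * y) + 2 * b * w) / (b\<^sup>2 - a\<^sup>2) + (2 * (c * K * y) + 2 * b * w) / (c\<^sup>2 - b\<^sup>2)
     + 2 * (2 * (a * K * (c * K)) + (a\<^sup>2 + c\<^sup>2) * K\<^sup>2) / (c\<^sup>2 - a\<^sup>2)
     = - 2 * g * K * y + 2 * (a + c) / (c - a) * K\<^sup>2 + 2 * b * \<beta> * (w + y * K)" for w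
  proof -
    \<comment> \<open>Writing \<open>a = b - (b - a)\<close> separates the sign-dependent part; the
      factor \<open>b - a\<close> then cancels against the denominator. The next fact does the same
      with \<open>c = b + (c - b)\<close>.\<close>
    have 1: "(2 * (a * K * y) + 2 * b * w) / (b\<^sup>2 - a\<^sup>2) = 2 * b / (b\<^sup>2 - a\<^sup>2) * (w + y * K) - 2 * (K * y) * (1 / (a + b))"
    proof -
      have "2 * (a * K * y) + 2 * b * w = 2 * b * (w + y * K) - 2 * (K * y) * (b - a)" by (simp add: algebra_simps)
      then show ?thesis using pos unfolding fact by (simp add: diff_divide_distrib)
    qed
    have 2: "(2 * (c * K * y) + 2 * b * w) / (c\<^sup>2 - b\<^sup>2) = 2 * b / (c\<^sup>2 - b\<^sup>2) * (w + y * K) + 2 * (K * y) * (1 / (b + c))"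
    proof -
      have "2 * (c * K * y) + 2 * b * w = 2 * b * (w + y * K) + 2 * (K * y) * (c - b)" by (simp add: algebra_simps)
      then show ?thesis using pos unfolding fact by (simp add: add_divide_distrib)
    qed
    have 3: "2 * (2 * (a * K * (c * K)) + (a\<^sup>2 + c\<^sup>2) * K\<^sup>2) / (c\<^sup>2 - a\<^sup>2) = 2 * (a + c) / (c - a) * K\<^sup>2"
    proof -
      have "2 * (2 * (a * K * (c * K)) + (a\<^sup>2 + c\<^sup>2) * K\<^sup>2) = 2 * (a + c) * K\<^sup>2 * (a + c)" by algebra
      then show ?thesis using pos unfolding fact by simp
    qed
    \<comment> \<open>The coefficient \<open>g\<close> collects what the pairs (1,2) and (2,3) leave
      over.\<close>
    have g: "g = 1 / (a + b) - 1 / (b + c)"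
      using pos unfolding g_def abc[symmetric] by (simp add: divide_simps)
    show ?thesis unfolding 1 2 3 g \<beta>_def abc[symmetric] by (simp add: algebra_simps)
  qed
  note gap = gap_eq[OF s k, folded abc]
  have R: "R = (2 * (a * K * y) + 2 * b * (u$2 * v$2 * k)) / (b\<^sup>2 - a\<^sup>2)
     + (2 * (c * K * y) + 2 * b * (u$2 * v$2 * k)) / (c\<^sup>2 - b\<^sup>2)
     + 2 * (2 * (a * K * (c * K)) + (a\<^sup>2 + c\<^sup>2) * k\<^sup>2) / (c\<^sup>2 - a\<^sup>2)"
    using id[of "u$2 * v$2 * k"] unfolding R_def abc[symmetric] by (simp add: K_def)
  have le: "(x + z) / d \<le> (x' + z) / d" if "x \<le> x'" "0 < d" for x x' z d :: real
    using that by (simp add: divide_right_mono)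
  have le2: "2 * (x + z) / d \<le> 2 * (x' + z) / d" if "x \<le> x'" "0 < d" for x x' z d :: real
    using that by (simp add: divide_right_mono)
  show "R \<le> gap s u v"
    unfolding R gap
    by (intro add_mono[OF add_mono] le le2 amgm[of "u$1" "v$1" "u$2" "v$2", unfolded yk, folded y_def]
        amgm[of "u$3" "v$3" "u$2" "v$2", unfolded yk, folded y_def] amgm[of "u$1" "v$1" "u$3" "v$3", unfolded yk])
      (use sq in auto)
  assume eq: "\<bar>u$1\<bar> = \<bar>v$1\<bar>" "\<bar>u$2\<bar> = \<bar>v$2\<bar>" "\<bar>u$3\<bar> = \<bar>v$3\<bar>"
  have amgm_eq: "2 * (\<bar>p * q\<bar> * \<bar>r * t\<bar>) = (p * t)\<^sup>2 + (r * q)\<^sup>2" if "\<bar>p\<bar> = \<bar>q\<bar>" "\<bar>r\<bar> = \<bar>t\<bar>" for p q r t :: real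
    unfolding power2_abs[of "p * t", symmetric] power2_abs[of "r * q", symmetric] abs_mult that by algebra
  show "gap s u v = R"
    unfolding R gap
    using amgm_eq[OF eq(1,2)] amgm_eq[OF eq(3,2)] amgm_eq[OF eq(1,3)]
    unfolding yk y_def[symmetric] by simp
qed

lemma critical_parameter:
  fixes s u v :: "real^3"
  assumes "0 < s$1" "0 < s$3" and "u$3 * v$3 / s$3 = u$1 * v$1 / s$1"
  obtains k where "u$3 * v$3 = s$3 * k" "u$1 * v$1 = s$1 * k"
  using that[of "u$1 * v$1 / s$1"] assms by (simp add: field_simps)

text \<open>Expresses the slack in the Cauchy-Schwarz bound as a sum of squares, so that equality
  forces \<open>\<bar>u$i\<bar> = \<bar>v$i\<bar>\<close>.\<close>

lemma sum_abs_products: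
  fixes u v :: "real^3"
  assumes "norm u = 1" "norm v = 1"
  shows "(\<bar>u$1\<bar> - \<bar>v$1\<bar>)\<^sup>2 + (\<bar>u$2\<bar> - \<bar>v$2\<bar>)\<^sup>2 + (\<bar>u$3\<bar> - \<bar>v$3\<bar>)\<^sup>2
    = 2 * (1 - (\<bar>u$1 * v$1\<bar> + \<bar>u$2 * v$2\<bar> + \<bar>u$3 * v$3\<bar>))"
  using norm_sq_3[of u] norm_sq_3[of v] assms by (simp add: power2_diff abs_mult)

section \<open>The optimal directions for a fixed diagonal matrix\<close>

locale ordered_diagonal =
  fixes s :: "real^3"
  assumes s: "0 < s$1" "s$1 < s$2" "s$2 < s$3"
begin

text \<open>If \<open>y = 1 - (s$1 + s$3) * K\<close> and the sign term vanishes, the bound of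
  \<open>gap_lower_bound\<close> becomes \<open>convexity * K^2 - 2 * rate * K\<close>. Its
  minimizer is \<open>opt\<close> and its minimum is \<open>- rate * opt\<close>.\<close>

definition "rate = (s$3 - s$1) / ((s$1 + s$2) * (s$2 + s$3))"
definition "convexity = 2 * (s$1 + s$3) * (rate + 1 / (s$3 - s$1))"
definition "opt = rate / convexity"
text \<open>The values of \<open>\<bar>u$i * v$i\<bar>\<close> at the minimum. Equality also
  requires \<open>\<bar>u$i\<bar> = \<bar>v$i\<bar>\<close>, whence the square roots in
  \<open>left\<close> and \<open>right\<close>.\<close>

definition weight :: "real^3" where
  "weight = vector [s$1 * opt, 1 - (s$1 + s$3) * opt, s$3 * opt]"
definition left :: "real^3" where "left = (\<chi> i. sqrt (weight $ i))"
text \<open>The middle sign makes \<open>u$2 * v$2\<close> opposite to the other two products, which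
  removes the sign term from the bound.\<close>

definition twist :: "real^3" where "twist = vector [1, -1, 1]"
definition right :: "real^3" where "right = (\<chi> i. twist $ i * sqrt (weight $ i))"

lemma rate_pos: "rate > 0" and convexity_pos: "convexity > 0" and opt_pos: "opt > 0"
  using s by (auto simp: rate_def convexity_def opt_def intro!: divide_pos_pos mult_pos_pos add_pos_pos)

text \<open>Only the middle entry needs an argument: \<open>2 * (s$1 + s$3) * opt\<close> is
  \<open>rate\<close> divided by something larger, hence below 1.\<close>

lemma weight_pos: "weight $ i > 0"
proof -
  have "2 * ((s$1 + s$3) * opt) = (2 * (s$1 + s$3) * rate) / (2 * (s$1 + s$3) * (rate + 1 / (s$3 - s$1)))"
    by (simp only: opt_def convexity_def times_divide_eq_right mult.assoc)
  also have "\<dots> = rate / (rate + 1 / (s$3 - s$1))"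
    using s by (intro mult_divide_mult_cancel_left) simp
  also have "\<dots> < 1" using s rate_pos by (simp add: add_pos_pos)
  finally have "weight $ 2 > 0" by (simp add: weight_def)
  moreover have "weight $ 1 > 0" "weight $ 3 > 0" using s opt_pos by (simp_all add: weight_def)
  ultimately show ?thesis using exhaust_3[of i] by auto
qed

lemma weight_sum: "weight $ 1 + weight $ 2 + weight $ 3 = 1"
  by (simp add: weight_def algebra_simps)

lemma twist_cases: "twist $ i \<in> {1, -1}"
  using exhaust_3[of i] by (auto simp: twist_def)

lemma norm_left: "norm left = 1" and norm_right: "norm right = 1"
proof -
  have "(sqrt (weight $ i))\<^sup>2 = weight $ i" for i using weight_pos[of i] by simp
  moreover have "(twist $ i)\<^sup>2 = 1" for i using twist_cases[of i] by auto
  ultimately have "(norm left)\<^sup>2 = 1" "(norm right)\<^sup>2 = 1"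
    by (simp_all add: norm_sq_3 left_def right_def power_mult_distrib weight_sum)
  then show "norm left = 1" "norm right = 1"
    by (metis norm_ge_zero power2_eq_1_iff norm_minus_cancel abs_norm_cancel abs_minus_cancel abs_one)+
qed

text \<open>Completes the square in \<open>K\<close> after splitting off the slack
  \<open>1 - (s$1 + s$3) * K - y\<close>. The variable \<open>r\<close> stands for the sign term, so
  that the right side becomes a sum of three terms that are nonnegative when applied.\<close>

lemma remainder_eq:
  "- 2 * rate * K * y + 2 * (s$1 + s$3) / (s$3 - s$1) * K\<^sup>2 + r + rate * opt =
     2 * rate * K * (1 - (s$1 + s$3) * K - y) + convexity * (K - opt)\<^sup>2 + r"
proof -
  have "convexity * opt = rate" using convexity_pos by (simp add: opt_def)
  moreover have "convexity * (K - opt)\<^sup>2 = convexity * K\<^sup>2 - 2 * (convexity * opt) * K + (convexity * opt) * opt"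
    by algebra
  ultimately have "convexity * (K - opt)\<^sup>2 = convexity * K\<^sup>2 - 2 * rate * K + rate * opt"
    by simp
  moreover have "convexity * K\<^sup>2 = 2 * (s$1 + s$3) * rate * K\<^sup>2 + 2 * (s$1 + s$3) / (s$3 - s$1) * K\<^sup>2"
    by (simp add: convexity_def algebra_simps add_divide_distrib)
  ultimately show ?thesis by (simp add: power2_eq_square algebra_simps)
qed

lemma beta_pos: "2 * s$2 * (1 / ((s$2)\<^sup>2 - (s$1)\<^sup>2) + 1 / ((s$3)\<^sup>2 - (s$2)\<^sup>2)) > 0"
  using s by (intro mult_pos_pos add_pos_pos divide_pos_pos) (auto intro!: power_strict_mono)

text \<open>The excess over the minimum dominates three nonnegative terms. At the minimum all three
  vanish, which fixes \<open>K\<close>, the slack and the sign of \<open>u$2 * v$2\<close>; only the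
  signs of the \<open>u$i\<close> and of \<open>k\<close> remain free.\<close>

lemma gap_minimum:
  assumes uv: "norm u = 1" "norm v = 1" and crit: "u$3 * v$3 / s$3 = u$1 * v$1 / s$1"
  shows "- rate * opt \<le> gap s u v"
    and "gap s u v \<le> - rate * opt \<Longrightarrow> \<exists>e d. e \<in> {1, -1} \<and> (\<forall>i. d i \<in> {1, -1}) \<and>
       (\<forall>i. u $ i = d i * left $ i \<and> v $ i = e * d i * right $ i)"
proof -
  obtain k where k: "u$3 * v$3 = s$3 * k" "u$1 * v$1 = s$1 * k"
    using critical_parameter[OF _ _ crit] s by auto
  define K where "K = \<bar>k\<bar>"
  define y where "y = \<bar>u$2 * v$2\<bar>"
  define \<beta> where "\<beta> = 2 * s$2 * (1 / ((s$2)\<^sup>2 - (s$1)\<^sup>2) + 1 / ((s$3)\<^sup>2 - (s$2)\<^sup>2))"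
  have \<beta>: "\<beta> > 0" using beta_pos by (simp add: \<beta>_def)
  have yk: "\<bar>u$1 * v$1\<bar> = s$1 * K" "\<bar>u$3 * v$3\<bar> = s$3 * K" using s k by (auto simp: K_def abs_mult)
  note sq = sum_abs_products[OF uv, unfolded yk, folded y_def]
  have "0 \<le> 2 * (1 - (s$1 * K + y + s$3 * K))" unfolding sq[symmetric] by simp
  then have slack: "0 \<le> 1 - (s$1 + s$3) * K - y" by (simp add: algebra_simps)
  have "\<bar>u$2 * v$2 * k\<bar> = y * K" by (simp add: y_def K_def abs_mult)
  then have w: "0 \<le> u$2 * v$2 * k + y * K" by linarith
  have K: "0 \<le> K" by (simp add: K_def)
  have terms: "0 \<le> 2 * rate * K * (1 - (s$1 + s$3) * K - y)" "0 \<le> convexity * (K - opt)\<^sup>2"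
    "0 \<le> \<beta> * (u$2 * v$2 * k + y * K)"
    using slack w K rate_pos convexity_pos \<beta> by (simp_all add: less_imp_le)
  note lower = gap_lower_bound(1)[OF s k, folded rate_def K_def y_def \<beta>_def]
  have bound: "2 * rate * K * (1 - (s$1 + s$3) * K - y) + convexity * (K - opt)\<^sup>2
       + \<beta> * (u$2 * v$2 * k + y * K) \<le> gap s u v + rate * opt"
    unfolding remainder_eq[symmetric] using lower by simp
  then show "- rate * opt \<le> gap s u v" using terms by linarith
  assume "gap s u v \<le> - rate * opt"
  then have "2 * rate * K * (1 - (s$1 + s$3) * K - y) = 0" "convexity * (K - opt)\<^sup>2 = 0"
    "\<beta> * (u$2 * v$2 * k + y * K) = 0" using bound terms by linarith+
  then have K_eq: "K = opt" and slack0: "1 - (s$1 + s$3) * K - y = 0" and w0: "u$2 * v$2 * k = - (y * K)"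
    using rate_pos convexity_pos opt_pos \<beta> by auto
  then have y_eq: "y = weight $ 2" by (simp add: weight_def)
  have "1 - (s$1 * K + y + s$3 * K) = 0" using slack0 by (simp add: algebra_simps)
  \<comment> \<open>Zero slack is the equality case of \<open>sum_abs_products\<close>.\<close>
  then have "(\<bar>u$1\<bar> - \<bar>v$1\<bar>)\<^sup>2 + (\<bar>u$2\<bar> - \<bar>v$2\<bar>)\<^sup>2 + (\<bar>u$3\<bar> - \<bar>v$3\<bar>)\<^sup>2 = 0"
    using sq by simp
  then have "\<bar>u$1\<bar> = \<bar>v$1\<bar>" "\<bar>u$2\<bar> = \<bar>v$2\<bar>" "\<bar>u$3\<bar> = \<bar>v$3\<bar>"
    by (smt (verit) zero_le_power2 zero_eq_power2)+
  then have abs_eq: "\<bar>u$i\<bar> = \<bar>v$i\<bar>" for i using exhaust_3[of i] by auto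
  have "\<bar>u$i * v$i\<bar> = weight $ i" for i
    using exhaust_3[of i] yk y_eq K_eq by (auto simp: y_def weight_def)
  moreover have "\<bar>u$i\<bar>\<^sup>2 = \<bar>u$i * v$i\<bar>" for i
    by (simp only: power2_eq_square abs_mult abs_eq)
  ultimately have "\<bar>u$i\<bar>\<^sup>2 = weight $ i" for i by simp
  then have left: "\<bar>u$i\<bar> = left $ i" for i
    by (metis left_def vec_lambda_beta real_sqrt_abs power2_abs)
  \<comment> \<open>The two free choices of sign. The sign of \<open>v$i\<close> follows from them,
    because \<open>u$i * v$i\<close> has sign \<open>e * twist $ i\<close>.\<close>
  define e where "e = sgn k"
  define d where "d i = sgn (u$i)" for i
  have "left $ i > 0" for i using weight_pos by (simp add: left_def)
  then have nz: "u $ i \<noteq> 0" for i using left[of i] by (metis abs_zero less_irrefl)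
  have k0: "k \<noteq> 0" using K_eq opt_pos by (auto simp: K_def)
  have sgn_uv: "sgn (u$i * v$i) = e * twist $ i" for i
  proof -
    have "sgn (u$1 * v$1) = e" "sgn (u$3 * v$3) = e" using k s by (simp_all add: sgn_mult e_def)
    moreover have "sgn (u$2 * v$2) = - e"
    proof -
      have "sgn (u$2 * v$2) * e = sgn (- (y * K))" unfolding e_def w0[symmetric] by (simp add: sgn_mult)
      also have "\<dots> = -1" using y_eq weight_pos[of 2] K_eq opt_pos by (simp add: sgn_mult)
      finally show ?thesis using k0 by (simp add: e_def sgn_if split: if_splits)
    qed
    ultimately show ?thesis using exhaust_3[of i] by (auto simp: twist_def)
  qed
  have "u $ i = d i * left $ i" for i
    using left[of i] by (metis d_def sgn_mult_abs)
  moreover have "v $ i = e * d i * right $ i" for i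
  proof -
    have "d i * d i = 1" using nz[of i] by (simp add: d_def sgn_if)
    then have "sgn (v$i) = d i * sgn (u$i * v$i)" by (simp add: d_def sgn_mult)
    moreover have "v $ i = sgn (v$i) * left $ i" using left[of i] abs_eq[of i] by (metis sgn_mult_abs)
    ultimately show ?thesis unfolding sgn_uv by (simp add: right_def left_def mult_ac)
  qed
  ultimately show "\<exists>e d. e \<in> {1, -1} \<and> (\<forall>i. d i \<in> {1, -1}) \<and>
       (\<forall>i. u $ i = d i * left $ i \<and> v $ i = e * d i * right $ i)"
    using nz k0 by (intro exI[of _ e] exI[of _ d]) (auto simp: e_def d_def sgn_if)
qed

text \<open>Every inequality behind the bound is an equality here. Both values of \<open>e\<close>
  are covered, so that the direction and its negative are available.\<close>

lemma gap_attained: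
  assumes "e \<in> {1, -1}"
  defines "u \<equiv> e *\<^sub>R left"
  shows "u$3 * right$3 / s$3 = u$1 * right$1 / s$1" "gap s u right = - rate * opt"
proof -
  define k where "k = e * opt"
  have sq: "sqrt (weight $ i) * sqrt (weight $ i) = weight $ i" for i using weight_pos[of i] by simp
  have uv: "u $ i * right $ i = e * twist $ i * weight $ i" for i
    using sq[of i] by (simp add: u_def left_def right_def)
  have k: "u$3 * right$3 = s$3 * k" "u$1 * right$1 = s$1 * k"
    unfolding uv by (simp_all add: k_def twist_def weight_def)
  then show "u$3 * right$3 / s$3 = u$1 * right$1 / s$1" using s by simp
  have "\<bar>twist $ i\<bar> = 1" for i using twist_cases[of i] by auto
  then have abs: "\<bar>u $ i\<bar> = \<bar>right $ i\<bar>" for i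
    using assms(1) by (auto simp: u_def left_def right_def abs_mult)
  have K: "\<bar>k\<bar> = opt" using assms(1) opt_pos by (auto simp: k_def)
  have y: "\<bar>u$2 * right$2\<bar> = weight $ 2" unfolding uv using assms(1) weight_pos[of 2] by (auto simp: twist_def)
  have w: "u$2 * right$2 * k + weight $ 2 * opt = 0" unfolding uv k_def using assms(1) by (auto simp: twist_def)
  \<comment> \<open>With zero slack and \<open>K = opt\<close>, the right side of
    \<open>remainder_eq\<close> vanishes for \<open>r = 0\<close>.\<close>
  have "1 - (s$1 + s$3) * opt - weight $ 2 = 0" by (simp add: weight_def)
  then have "- 2 * rate * opt * weight $ 2 + 2 * (s$1 + s$3) / (s$3 - s$1) * opt\<^sup>2 + rate * opt = 0"
    using remainder_eq[of opt "weight $ 2" 0] by simp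
  then show "gap s u right = - rate * opt"
    using gap_lower_bound(2)[OF s k abs abs abs] unfolding K y w rate_def[symmetric] by simp
qed

text \<open>On critical directions the second derivative is a positive multiple of
  \<open>gap\<close>. The pair \<open>left\<close>, \<open>right\<close> serves as competitor in one
  direction; in the other, negativity holds because the minimum itself is negative.\<close>

lemma extremal_direction_diag3_iff:
  assumes uv: "norm u = 1" "norm v = 1"
  shows "extremal_direction (diag3 s) (tensor u v) \<longleftrightarrow>
    u$3 * v$3 / s$3 = u$1 * v$1 / s$1 \<and> gap s u v = - rate * opt"
proof -
  have pos: "s$3 / s$1 > 0" using s by simp
  have d1: "distortion_deriv1 (diag3 s) (tensor u v) = 0 \<longleftrightarrow> u$3 * v$3 / s$3 = u$1 * v$1 / s$1" for u v
    unfolding distortion_diag3(1)[OF s] using pos by auto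
  have d2: "distortion_deriv2 (diag3 s) (tensor u v) = s$3 / s$1 * gap s u v"
    if "u$3 * v$3 / s$3 = u$1 * v$1 / s$1" for u v
    unfolding gap_def by (rule distortion_diag3(2)[OF s that])
  have neg: "- rate * opt < 0" using rate_pos opt_pos by simp
  have opt_crit: "left$3 * right$3 / s$3 = left$1 * right$1 / s$1" and opt_gap: "gap s left right = - rate * opt"
    using gap_attained[of 1] by simp_all
  show ?thesis
  proof
    assume "extremal_direction (diag3 s) (tensor u v)"
    then have crit: "u$3 * v$3 / s$3 = u$1 * v$1 / s$1"
      and "distortion_deriv2 (diag3 s) (tensor u v) \<le> distortion_deriv2 (diag3 s) (tensor left right)"
      unfolding extremal_direction_def d1 using norm_left norm_right opt_crit by auto
    then have "gap s u v \<le> - rate * opt"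
      by (simp only: d2 opt_crit opt_gap mult_le_cancel_left_pos[OF pos])
    with crit show "u$3 * v$3 / s$3 = u$1 * v$1 / s$1 \<and> gap s u v = - rate * opt"
      using gap_minimum(1)[OF uv crit] by simp
  next
    assume *: "u$3 * v$3 / s$3 = u$1 * v$1 / s$1 \<and> gap s u v = - rate * opt"
    show "extremal_direction (diag3 s) (tensor u v)"
      unfolding extremal_direction_def d1
    proof (intro conjI allI impI)
      show "u$3 * v$3 / s$3 = u$1 * v$1 / s$1" using * by blast
      show "distortion_deriv2 (diag3 s) (tensor u v) < 0"
        using * pos neg by (simp only: d2 mult_pos_neg)
      fix p q :: "real^3"
      assume pq: "norm p = 1 \<and> norm q = 1 \<and> p$3 * q$3 / s$3 = p$1 * q$1 / s$1"
      then show "distortion_deriv2 (diag3 s) (tensor u v) \<le> distortion_deriv2 (diag3 s) (tensor p q)"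
        using gap_minimum(1)[of p q] * by (simp only: d2 mult_le_cancel_left_pos[OF pos])
    qed
  qed
qed

end

section \<open>Singular value decomposition\<close>

lemma orthogonal_matrix_mult_cancel:
  assumes "orthogonal_matrix (U :: real^'n^'n)"
  shows "U *v (transpose U *v x) = x" "transpose U *v (U *v x) = x"
  using assms unfolding orthogonal_matrix_def matrix_vector_mul_assoc by simp_all

lemma norm_orthogonal_mult:
  assumes "orthogonal_matrix (U :: real^'n^'n)"
  shows "norm (U *v x) = norm x" "norm (transpose U *v x) = norm x"
proof -
  have *: "norm (W *v x) = norm x" if "orthogonal_matrix W" for W :: "real^'n^'n"
  proof -
    have "(norm (W *v x))\<^sup>2 = (norm x)\<^sup>2"
      unfolding norm_matrix_vector_sq using that by (simp add: orthogonal_matrix power2_norm_eq_inner)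
    then show ?thesis by simp
  qed
  show "norm (U *v x) = norm x" "norm (transpose U *v x) = norm x"
    using *[of U] *[of "transpose U"] assms by (simp_all only: orthogonal_matrix_transpose)
qed

text \<open>The orthogonal matrix \<open>V\<close> permutes the unit sphere and \<open>U\<close>
  preserves norms, so supremum and infimum run over the same set of values.\<close>

lemma linear_distortion_orthogonal:
  fixes U V M :: "real^'n^'n"
  assumes "orthogonal_matrix U" "orthogonal_matrix V"
  shows "linear_distortion (U ** M ** transpose V) = linear_distortion M"
proof -
  have "(\<lambda>z. norm ((U ** M ** transpose V) *v z)) ` sphere 0 1 = (\<lambda>z. norm (M *v z)) ` sphere 0 1"
    (is "?f ` _ = ?g ` _")
  proof
    have f: "?f z = ?g (transpose V *v z)" for z
      by (simp only: matrix_vector_mul_assoc[symmetric] norm_orthogonal_mult[OF assms(1)])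
    show "?f ` sphere 0 1 \<subseteq> ?g ` sphere 0 1"
      using norm_orthogonal_mult[OF assms(2)] by (auto simp: f)
    show "?g ` sphere 0 1 \<subseteq> ?f ` sphere 0 1"
    proof (rule image_subsetI)
      fix z :: "real^'n" assume "z \<in> sphere 0 1"
      then have "V *v z \<in> sphere 0 1" using norm_orthogonal_mult[OF assms(2)] by simp
      moreover have "?g z = ?f (V *v z)" unfolding f using orthogonal_matrix_mult_cancel[OF assms(2)] by simp
      ultimately show "?g z \<in> ?f ` sphere 0 1" by (simp only: image_eqI)
    qed
  qed
  then show ?thesis unfolding linear_distortion_def by (simp only:)
qed

lemma tensor_mult: "U ** tensor u v ** transpose V = tensor (U *v u) (V *v v)"
  by (simp add: vec_eq_iff matrix_matrix_mult_def tensor_def transpose_def matrix_vector_mult_def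
      sum_distrib_left sum_distrib_right mult_ac)

lemma matrix_mult_scaleR: "U ** (k *\<^sub>R N) ** W = k *\<^sub>R (U ** N ** W)" for U N W :: "real^'n^'n"
  by (simp only: matrix_scalar_ac scalar_matrix_assoc[symmetric])

lemma matrix_mult_line: "U ** (M + t *\<^sub>R N) ** W = U ** M ** W + t *\<^sub>R (U ** N ** W)"
  for U M N W :: "real^'n^'n"
proof -
  have "(X + Y) ** W = X ** W + Y ** W" for X Y :: "real^'n^'n"
    by (simp add: vec_eq_iff matrix_matrix_mult_def distrib_right sum.distrib)
  then show ?thesis by (simp only: matrix_add_ldistrib matrix_mult_scaleR[symmetric])
qed

lemma linear_distortion_line_orthogonal:
  fixes U V M B :: "real^'n^'n"
  assumes "orthogonal_matrix U" "orthogonal_matrix V"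
  shows "linear_distortion (U ** M ** transpose V + t *\<^sub>R (U ** B ** transpose V)) = linear_distortion (M + t *\<^sub>R B)"
  using linear_distortion_orthogonal[OF assms, of "M + t *\<^sub>R B"] by (simp only: matrix_mult_line)

lemma extremal_direction_orthogonal:
  fixes U V M :: "real^'n^'n"
  assumes U: "orthogonal_matrix U" and V: "orthogonal_matrix V"
  shows "extremal_direction (U ** M ** transpose V) (tensor (U *v u) (V *v v)) \<longleftrightarrow> extremal_direction M (tensor u v)"
proof -
  have d1: "distortion_deriv1 (U ** M ** transpose V) (tensor (U *v u) (V *v v)) = distortion_deriv1 M (tensor u v)"
    and d2: "distortion_deriv2 (U ** M ** transpose V) (tensor (U *v u) (V *v v)) = distortion_deriv2 M (tensor u v)"
    for u v
    unfolding distortion_deriv1_def distortion_deriv2_def tensor_mult[symmetric]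
      linear_distortion_line_orthogonal[OF U V] by (rule refl)+
  \<comment> \<open>Since \<open>U\<close> and \<open>V\<close> are surjective, the competitors may
    be written in the new coordinates.\<close>
  have all: "(\<forall>p q. P p q) \<longleftrightarrow> (\<forall>p q. P (U *v p) (V *v q))" for P
    using orthogonal_matrix_mult_cancel(1)[OF U] orthogonal_matrix_mult_cancel(1)[OF V] by metis
  show ?thesis
    unfolding extremal_direction_def d1 d2
    by (subst (1) all) (simp only: d1 d2 norm_orthogonal_mult[OF U] norm_orthogonal_mult[OF V])
qed

text \<open>The decomposition provided by \<open>equal_up_to_sign\<close> need not be the one fixed
  elsewhere, so the conclusion speaks only of the distortion along lines through \<open>A\<close>.
  Conjugation by a diagonal sign matrix fixes \<open>S\<close> and is orthogonal, hence preserves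
  that distortion.\<close>

lemma equal_up_to_sign_line:
  fixes A B B' :: "real^'n^'n"
  assumes "equal_up_to_sign A B B'"
  obtains e where "e \<in> {1, -1}"
    "\<And>t. linear_distortion (A + t *\<^sub>R B') = linear_distortion (A + t *\<^sub>R (e *\<^sub>R B))"
proof -
  obtain U S V e d where svd: "singular_value_decomposition A U S V"
    and e: "e \<in> {1, -1 :: real}" and d: "\<forall>i. d i \<in> {1, -1 :: real}"
    and eq: "\<forall>i j. (transpose U ** B' ** V) $ i $ j = e * d i * d j * (transpose U ** B ** V) $ i $ j"
    using assms unfolding equal_up_to_sign_def by blast
  have U: "orthogonal_matrix U" "orthogonal_matrix (transpose U)" and V: "orthogonal_matrix V" "orthogonal_matrix (transpose V)"
    and S: "\<And>i j. i \<noteq> j \<Longrightarrow> S $ i $ j = 0" and A: "A = U ** S ** transpose V"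
    using svd by (auto simp: singular_value_decomposition_def orthogonal_matrix_transpose)
  define D where "D = (\<chi> i j. if i = j then d i else 0)"
  have dd: "d i * d i = 1" for i using d[rule_format, of i] by auto
  have DMD: "(D ** M ** transpose D) $ i $ j = d i * d j * M $ i $ j" for M i j
  proof -
    have "(D ** M) $ i $ j = (\<Sum>k\<in>UNIV. if i = k then d i * M $ i $ j else 0)" for M :: "real^'n^'n" and i j
      unfolding D_def matrix_matrix_mult_def vec_lambda_beta by (intro sum.cong) auto
    then have DM: "(D ** M) $ i $ j = d i * M $ i $ j" for M :: "real^'n^'n" and i j by simp
    have "(M ** transpose D) $ i $ j = (\<Sum>k\<in>UNIV. if j = k then d j * M $ i $ j else 0)" for M :: "real^'n^'n" and i j
      unfolding D_def matrix_matrix_mult_def transpose_def vec_lambda_beta by (intro sum.cong) auto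
    then have "(M ** transpose D) $ i $ j = d j * M $ i $ j" for M :: "real^'n^'n" and i j by simp
    then show ?thesis by (simp add: DM)
  qed
  have D: "orthogonal_matrix D"
  proof -
    \<comment> \<open>Orthogonality of \<open>D\<close> is the entry formula \<open>DMD\<close>
      applied to the identity matrix.\<close>
    have "D ** mat 1 ** transpose D = mat 1"
      unfolding vec_eq_iff DMD by (auto simp: mat_def dd)
    then have "D ** transpose D = mat 1" by simp
    then show ?thesis unfolding orthogonal_matrix_def using matrix_left_right_inverse by blast
  qed
  have DS: "D ** S ** transpose D = S"
    unfolding vec_eq_iff DMD
  proof (intro allI)
    show "d i * d j * S $ i $ j = S $ i $ j" for i j
      using S[of i j] dd[of i] by (cases "i = j") simp_all
  qed
  have "transpose U ** A ** V = (transpose U ** U) ** S ** (transpose V ** V)"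
    unfolding A by (simp only: matrix_mul_assoc)
  then have TA: "transpose U ** A ** V = S"
    using U(1) V(1) by (simp add: orthogonal_matrix)
  have line: "linear_distortion (A + t *\<^sub>R N) = linear_distortion (S + t *\<^sub>R (transpose U ** N ** V))" for t N
    using linear_distortion_line_orthogonal[OF U(2) V(2), of A t N] by (simp only: TA transpose_transpose)
  have "transpose U ** B' ** V = D ** (transpose U ** (e *\<^sub>R B) ** V) ** transpose D"
    unfolding vec_eq_iff DMD using eq by (simp add: matrix_mult_scaleR)
  then have "linear_distortion (A + t *\<^sub>R B') = linear_distortion (A + t *\<^sub>R (e *\<^sub>R B))" for t
    unfolding line using linear_distortion_line_orthogonal[OF D D, of S t "transpose U ** (e *\<^sub>R B) ** V"]
    by (simp only: DS)
  with e that show thesis by blast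
qed

section \<open>Existence of an ordered singular value decomposition\<close>

lemma card_3_sorted:
  fixes X :: "real set"
  assumes "card X = 3"
  obtains a b c where "a < b" "b < c" "X = {a, b, c}"
proof -
  define xs where "xs = sorted_list_of_set X"
  have "finite X" using assms card.infinite by fastforce
  then have xs: "length xs = 3" "sorted_wrt (<) xs" "set xs = X"
    using assms by (simp_all add: xs_def)
  then obtain a b c where "xs = [a, b, c]"
    by (auto simp: numeral_3_eq_3 length_Suc_conv)
  with xs that[of a b c] show thesis by auto
qed

text \<open>The columns of \<open>V\<close> are unit eigenvectors \<open>w j\<close> of the Gram
  matrix, and those of \<open>U\<close> are the images \<open>A *v w j\<close> divided by
  \<open>s $ j\<close>. Distinct eigenvalues make the eigenvectors orthogonal, and invertibility
  excludes a zero singular value.\<close>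

lemma svd_distinct:
  fixes A :: "real^3^3"
  assumes "det A > 0" "has_distinct_singular_values A"
  obtains U V s where "0 < s$1" "s$1 < s$2" "s$2 < s$3"
    "orthogonal_matrix U" "orthogonal_matrix V" "A = U ** diag3 s ** transpose V"
proof -
  obtain a b c where abc: "a < b" "b < c" "singular_values A = {a, b, c}"
    using card_3_sorted[of "singular_values A"] assms(2) by (auto simp: has_distinct_singular_values_def)
  define s :: "real^3" where "s = vector [a, b, c]"
  have s_nth: "s$1 = a" "s$2 = b" "s$3 = c" by (simp_all add: s_def)
  have inner_A: "(A *v x) \<bullet> (A *v y) = x \<bullet> ((transpose A ** A) *v y)" for x y
    by (metis dot_lmul_matrix inner_commute matrix_vector_mul_assoc transpose_matrix_vector)
  have "\<exists>w. w \<noteq> 0 \<and> (transpose A ** A) *v w = (s$i)\<^sup>2 *\<^sub>R w" and s_nonneg: "0 \<le> s $ i" for i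
  proof -
    have "s $ i \<in> singular_values A" using exhaust_3[of i] abc s_nth by auto
    then show "\<exists>w. w \<noteq> 0 \<and> (transpose A ** A) *v w = (s$i)\<^sup>2 *\<^sub>R w" "0 \<le> s $ i"
      by (auto simp: singular_values_def)
  qed
  then obtain w' where w': "\<And>i. w' i \<noteq> 0" "\<And>i. (transpose A ** A) *v w' i = (s$i)\<^sup>2 *\<^sub>R w' i" by metis
  define w where "w i = (1 / norm (w' i)) *\<^sub>R w' i" for i
  have norm_w: "w i \<bullet> w i = 1" for i
    using w'(1)[of i] by (simp add: w_def power2_norm_eq_inner[symmetric] power2_eq_square)
  have eig: "(transpose A ** A) *v w i = (s$i)\<^sup>2 *\<^sub>R w i" for i
    by (simp only: w_def matrix_vector_mult_scaleR w'(2) scaleR_left_commute)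
  have inner_Aw: "(A *v w i) \<bullet> (A *v w j) = (s$j)\<^sup>2 * (w i \<bullet> w j)" for i j
    by (simp only: inner_A eig inner_scaleR_right)
  have s_pos: "0 < s $ i" for i
  proof -
    have "A *v w i \<noteq> 0"
    proof
      assume "A *v w i = 0"
      moreover have "invertible A" using assms(1) by (simp add: invertible_det_nz)
      ultimately have "w i = 0" by (auto simp: invertible_left_inverse matrix_left_invertible_ker)
      then show False using norm_w[of i] by simp
    qed
    then have "(s$i)\<^sup>2 \<noteq> 0" using inner_Aw[of i i] norm_w[of i] by auto
    then show ?thesis using s_nonneg[of i] by (simp add: less_le)
  qed
  have "s $ i \<noteq> s $ j" if "i \<noteq> j" for i j
    using that exhaust_3[of i] exhaust_3[of j] abc(1,2) s_nth by auto
  then have s_ne: "(s$i)\<^sup>2 \<noteq> (s$j)\<^sup>2" if "i \<noteq> j" for i j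
    using that s_pos[of i] s_pos[of j] by (simp add: power2_eq_iff_nonneg)
  have w_orth: "w i \<bullet> w j = 0" if "i \<noteq> j" for i j
  proof -
    \<comment> \<open>The inner product of \<open>A *v w i\<close> and \<open>A *v w j\<close> is
      evaluated in both orders.\<close>
    have "(s$j)\<^sup>2 * (w i \<bullet> w j) = (s$i)\<^sup>2 * (w i \<bullet> w j)"
      using inner_Aw[of i j] inner_Aw[of j i] by (simp add: inner_commute)
    then show ?thesis using s_ne[OF that] by simp
  qed
  define V where "V = (\<chi> i j. w j $ i)"
  define U where "U = (\<chi> i j. (A *v w j) $ i / s $ j)"
  have V: "orthogonal_matrix V"
  proof -
    have "(transpose V ** V) $ i $ j = w i \<bullet> w j" for i j
      by (simp add: V_def matrix_matrix_mult_def transpose_def inner_vec_def)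
    then have "transpose V ** V = mat 1"
      by (auto simp: vec_eq_iff mat_def norm_w w_orth)
    then show ?thesis by (simp add: orthogonal_matrix)
  qed
  have U: "orthogonal_matrix U"
  proof -
    have "(transpose U ** U) $ i $ j = (A *v w i) \<bullet> (A *v w j) / (s $ i * s $ j)" for i j
      by (simp add: U_def matrix_matrix_mult_def transpose_def inner_vec_def sum_divide_distrib)
    then have "(transpose U ** U) $ i $ j = (if i = j then 1 else 0)" for i j
      using s_pos[of i] by (auto simp: inner_Aw norm_w w_orth power2_eq_square)
    then have "transpose U ** U = mat 1"
      by (simp add: vec_eq_iff mat_def)
    then show ?thesis by (simp add: orthogonal_matrix)
  qed
  have "(U ** diag3 s) $ i $ j = (A ** V) $ i $ j" for i j
  proof -
    have "(U ** diag3 s) $ i $ j = (\<Sum>k\<in>UNIV. if k = j then U $ i $ j * s $ j else 0)"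
      unfolding diag3_def matrix_matrix_mult_def vec_lambda_beta by (intro sum.cong) auto
    also have "\<dots> = (A *v w j) $ i" using s_pos[of j] by (simp add: U_def)
    finally show ?thesis by (simp add: V_def matrix_matrix_mult_def matrix_vector_mult_def)
  qed
  then have "U ** diag3 s = A ** V" by (simp add: vec_eq_iff)
  then have "U ** diag3 s ** transpose V = A"
    using V by (simp add: orthogonal_matrix_def flip: matrix_mul_assoc)
  then show thesis using that[of s U V] s_pos[of 1] U V abc(1,2) s_nth by simp
qed

theorem theorem3:
  fixes A :: "real^3^3"
  assumes "det A > 0" and "has_distinct_singular_values A"
  shows "\<exists>u0 v0 :: real^3. norm u0 = 1 \<and> norm v0 = 1 \<and>
    extremal_direction A (tensor u0 v0) \<and>
    (\<forall>u v. norm u = 1 \<and> norm v = 1 \<longrightarrow>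
       (extremal_direction A (tensor u v) \<longleftrightarrow>
        equal_up_to_sign A (tensor u0 v0) (tensor u v)))"
proof -
  obtain U V s where s: "0 < s$1" "s$1 < s$2" "s$2 < s$3"
    and U: "orthogonal_matrix U" and V: "orthogonal_matrix V" and A: "A = U ** diag3 s ** transpose V"
    by (rule svd_distinct[OF assms])
  interpret ordered_diagonal s using s by unfold_locales
  define u0 where "u0 = U *v left"
  define v0 where "v0 = V *v right"
  have norms: "norm u0 = 1" "norm v0 = 1"
    by (simp_all only: u0_def v0_def norm_orthogonal_mult[OF U] norm_orthogonal_mult[OF V] norm_left norm_right)
  \<comment> \<open>Both signs are treated because \<open>equal_up_to_sign_line\<close> recovers the
    line of \<open>tensor u0 v0\<close> only up to a factor \<open>e\<close>.\<close>
  have optimal: "extremal_direction A (tensor (e *\<^sub>R u0) v0)" if e: "e \<in> {1, -1}" for e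
  proof -
    have "norm (e *\<^sub>R left) = 1" using e norm_left by auto
    then have "extremal_direction (diag3 s) (tensor (e *\<^sub>R left) right)"
      using extremal_direction_diag3_iff[OF _ norm_right] gap_attained[OF e] by blast
    then show ?thesis
      unfolding A u0_def v0_def matrix_vector_mult_scaleR[symmetric] extremal_direction_orthogonal[OF U V] .
  qed
  have "extremal_direction A (tensor u v) \<longleftrightarrow> equal_up_to_sign A (tensor u0 v0) (tensor u v)"
    if uv: "norm u = 1" "norm v = 1" for u v
  proof
    \<comment> \<open>Singular coordinates of the given direction, in which
      \<open>gap_minimum\<close> determines all entries up to signs.\<close>
    define p where "p = transpose U *v u"
    define q where "q = transpose V *v v"
    have pq: "norm p = 1" "norm q = 1"
      by (simp_all only: p_def q_def norm_orthogonal_mult[OF U] norm_orthogonal_mult[OF V] uv)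
    have u: "u = U *v p" and v: "v = V *v q"
      by (simp_all only: p_def q_def orthogonal_matrix_mult_cancel[OF U] orthogonal_matrix_mult_cancel[OF V])
    assume "extremal_direction A (tensor u v)"
    then have "extremal_direction (diag3 s) (tensor p q)"
      unfolding A u v extremal_direction_orthogonal[OF U V] .
    then obtain e d where e: "e \<in> {1, -1}" and d: "\<forall>i. d i \<in> {1, -1}"
      and eq: "\<forall>i. p $ i = d i * left $ i \<and> q $ i = e * d i * right $ i"
      using gap_minimum(2)[OF pq] unfolding extremal_direction_diag3_iff[OF pq] by auto
    have T: "transpose U ** tensor (U *v x) (V *v y) ** V = tensor x y" for x y
      using tensor_mult[of "transpose U" "U *v x" "V *v y" "transpose V"]
      by (simp only: transpose_transpose orthogonal_matrix_mult_cancel[OF U] orthogonal_matrix_mult_cancel[OF V])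
    have "(transpose U ** tensor u v ** V) $ i $ j =
        e * d i * d j * (transpose U ** tensor u0 v0 ** V) $ i $ j" for i j
      unfolding u v u0_def v0_def T using eq by (simp add: tensor_def)
    moreover have "singular_value_decomposition A U (diag3 s) V"
    proof -
      have "diag3 s $ i $ i \<ge> 0" for i using exhaust_3[of i] s by (auto simp: diag3_def)
      then show ?thesis
        unfolding singular_value_decomposition_def using U V A by (simp add: diag3_def)
    qed
    ultimately show "equal_up_to_sign A (tensor u0 v0) (tensor u v)"
      unfolding equal_up_to_sign_def using e d by blast
  next
    assume "equal_up_to_sign A (tensor u0 v0) (tensor u v)"
    then obtain e where e: "e \<in> {1, -1}" and
      line: "\<And>t. linear_distortion (A + t *\<^sub>R tensor u v) = linear_distortion (A + t *\<^sub>R (e *\<^sub>R tensor u0 v0))"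
      using equal_up_to_sign_line by metis
    \<comment> \<open>The sign is absorbed into the left vector, which brings the direction into the
      form covered by \<open>optimal\<close>.\<close>
    have "e *\<^sub>R tensor u0 v0 = tensor (e *\<^sub>R u0) v0" by (simp add: vec_eq_iff tensor_def)
    then have "distortion_deriv1 A (tensor u v) = distortion_deriv1 A (tensor (e *\<^sub>R u0) v0)"
      "distortion_deriv2 A (tensor u v) = distortion_deriv2 A (tensor (e *\<^sub>R u0) v0)"
      unfolding distortion_deriv1_def distortion_deriv2_def line by (simp_all only:)
    then show "extremal_direction A (tensor u v)"
      using optimal[OF e] unfolding extremal_direction_def by simp
  qed
  then show ?thesis using norms optimal[of 1] by (intro exI[of _ u0] exI[of _ v0]) simp
qed

end
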